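(* Let $v(\sigma,t)$ be a sufficiently smooth real function on $\mathbb{R}\times[0,T]$, $2\pi$-periodic in $\sigma$, with $\int_0^{2\pi}v(\sigma,t)\,d\sigma=0$, satisfying $$\frac{\partial v}{\partial t}+\frac{\delta}{R^4}\frac{\partial^4v}{\partial\sigma^4}+\frac1{R^2}\Big(\alpha-1+\frac{\delta}{R^2}\Big)\frac{\partial^2v}{\partial\sigma^2}+\frac{\alpha-1}{R^2}v-\frac{v_c}{R^2}v\frac{\partial v}{\partial\sigma}=0,\qquad R=R(t),$$ and let $M>0$ be a constant with $\sup_{0\le t\le T}\|\partial v/\partial\sigma(\cdot,t)\|_\infty\le M$. Let $\boldsymbol v^n\in\mathbb{R}^J_{\mathrm{per}}$, $v^n_i=v(\sigma_i,t^n)$. Suppose $\boldsymbol V^0=\boldsymbol v^0$ and that $\boldsymbol V^1,\dots,\boldsymbol V^N\in\mathbb{R}^J_{\mathrm{per}}$ are produced by the Newton-type linearized scheme described in the context, with any prescribed numbers of iterations $j_n\ge1$. Then, for all sufficiently small $k$ and $h$ satisfying $k=o(h^{1/4})$, $$\max_{0\le n\le N}\|\boldsymbol v^n-\boldsymbol V^n\|_h\le c\,(k^2+h^2)$$ with a constant $c$ independent of $k$ and $h$. (That is: for every function $\omega$ with $\omega(h)\to0$ as $h\to0$ there are $k_0,h_0,c>0$ such that the estimate holds whenever $k\le k_0$, $h\le h_0$ and $k\le\omega(h)h^{1/4}$.)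
   Context: Constants and radius: $\delta>0$, $\alpha>0$, $v_c\in\mathbb{R}$, $T>0$ are fixed. $R:[0,T]\to(0,\infty)$ is a given solution of $\dot R=v_c+(\alpha-1)/R$, $R(0)=R_0>0$, which is expanding ($\dot R>0$). Grid: $J,N\in\mathbb{N}$, $h=2\pi/J$, $\sigma_i=ih$ ($i\in\mathbb{Z}$), $k=T/N$, $t^n=nk$; $R_m=R(mk)$ for integer or half-integer $m$. $\mathbb{R}^J_{\mathrm{per}}=\{\boldsymbol V=(V_i)_{i\in\mathbb{Z}}: V_i\in\mathbb{R},\ V_{i+J}=V_i\}$, with norm $\|\boldsymbol V\|_h=(h\sum_{i=1}^JV_i^2)^{1/2}$. For $\boldsymbol V,\boldsymbol W\in\mathbb{R}^J_{\mathrm{per}}$: $\Delta_hV_i=h^{-2}(V_{i-1}-2V_i+V_{i+1})$, $\Delta_h^2V_i=h^{-2}(\Delta_hV_{i-1}-2\Delta_hV_i+\Delta_hV_{i+1})$, $$(\mathcal L_h^m\boldsymbol V)_i=\frac{\delta}{R_m^4}\Delta_h^2V_i+\frac1{R_m^2}\Big(\alpha-1+\frac{\delta}{R_m^2}\Big)\Delta_hV_i+\frac{\alpha-1}{R_m^2}V_i,$$ $$(\boldsymbol\varphi(\boldsymbol V,\boldsymbol W))_i=(V_{i-1}+V_i+V_{i+1})(W_{i+1}-W_{i-1}),$$ $$(\boldsymbol\psi(\boldsymbol V,\boldsymbol W))_i=-(2V_{i-1}+V_i)W_{i-1}+(V_{i+1}-V_{i-1})W_i+(2V_{i+1}+V_i)W_{i+1}.$$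 Standing assumption: the grid initial data have zero discrete mean, $h\sum_{i=1}^Jv^0_i=0$. Newton-type scheme: $\boldsymbol V^0=\boldsymbol v^0$; $\boldsymbol V^1$ solves the linear system $$\frac1k(\boldsymbol V^1-\boldsymbol V^0)+\frac12\mathcal L_h^{\frac12}(\boldsymbol V^1+\boldsymbol V^0)=\frac{v_c}{6hR_{1/2}^2}\boldsymbol\varphi(\boldsymbol v^0,\boldsymbol v^0).$$ For $1\le n\le N-1$ put $\hat{\boldsymbol V}^{n+1}=2\boldsymbol V^n-\boldsymbol V^{n-1}$, $\boldsymbol W^{n+1,0}=\hat{\boldsymbol V}^{n+1}$, and for $j=0,\dots,j_{n+1}-1$ let $\boldsymbol W^{n+1,j+1}$ solve the linear system $$\frac1k(\boldsymbol W^{n+1,j+1}-\boldsymbol V^n)+\frac12\mathcal L_h^{n+\frac12}(\boldsymbol W^{n+1,j+1}+\boldsymbol V^n)=\frac{v_c}{24hR_{n+\frac12}^2}\Big(\boldsymbol\psi(\boldsymbol V^n+\hat{\boldsymbol V}^{n+1},\boldsymbol W^{n+1,j}-\hat{\boldsymbol V}^{n+1})+\boldsymbol\varphi(\boldsymbol V^n+\hat{\boldsymbol V}^{n+1},\boldsymbol V^n+\hat{\boldsymbol V}^{n+1})\Big);$$ then $\boldsymbol V^{n+1}=\boldsymbol W^{n+1,j_{n+1}}$. The data $\delta,\alpha,v_c,T,R,v,M$ are fixed before $c$ and the smallness thresholds are chosen. *)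

theory Defs
  imports "HOL-Analysis.Analysis"
begin

definition expanding_radius :: "real \<Rightarrow> real \<Rightarrow> real \<Rightarrow> real \<Rightarrow> (real \<Rightarrow> real) \<Rightarrow> bool" where
  "expanding_radius \<alpha> v_c T R0 R \<longleftrightarrow>
     R 0 = R0 \<and> 0 < R0 \<and>
     (\<forall>t\<in>{0..T}. 0 < R t \<and>
        (R has_real_derivative (v_c + (\<alpha> - 1) / R t)) (at t within {0..T}) \<and>
        0 < v_c + (\<alpha> - 1) / R t)"

text \<open>
  Functions \<open>v \<sigma> t\<close> of class C^p on the closed strip \<open>\<sigma> \<in> UNIV\<close>, \<open>t \<in> {0..T}\<close>. Time derivatives
  at \<open>t = 0\<close> and \<open>t = T\<close> are one-sided; values outside the strip play no role.
\<close>
primrec Cp_strip :: "nat \<Rightarrow> real \<Rightarrow> (real \<Rightarrow> real \<Rightarrow> real) \<Rightarrow> bool" where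
  "Cp_strip 0 T v \<longleftrightarrow> continuous_on (UNIV \<times> {0..T}) (\<lambda>(\<sigma>, t). v \<sigma> t)"
| "Cp_strip (Suc p) T v \<longleftrightarrow>
     continuous_on (UNIV \<times> {0..T}) (\<lambda>(\<sigma>, t). v \<sigma> t) \<and>
     (\<exists>v\<sigma> vt.
        (\<forall>\<sigma>. \<forall>t\<in>{0..T}.
           ((\<lambda>s. v s t) has_real_derivative v\<sigma> \<sigma> t) (at \<sigma>) \<and>
           ((\<lambda>\<tau>. v \<sigma> \<tau>) has_real_derivative vt \<sigma> t) (at t within {0..T})) \<and>
        Cp_strip p T v\<sigma> \<and> Cp_strip p T vt)"

definition solves_pde ::
  "real \<Rightarrow> real \<Rightarrow> real \<Rightarrow> real \<Rightarrow> (real \<Rightarrow> real) \<Rightarrow> (real \<Rightarrow> real \<Rightarrow> real) \<Rightarrow> bool" where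
  "solves_pde \<delta> \<alpha> v_c T R v \<longleftrightarrow>
     (\<forall>\<sigma>. \<forall>t\<in>{0..T}. \<exists>vt.
        ((\<lambda>\<tau>. v \<sigma> \<tau>) has_real_derivative vt) (at t within {0..T}) \<and>
        vt + \<delta> / R t ^ 4 * (deriv ^^ 4) (\<lambda>s. v s t) \<sigma>
           + 1 / R t ^ 2 * (\<alpha> - 1 + \<delta> / R t ^ 2) * (deriv ^^ 2) (\<lambda>s. v s t) \<sigma>
           + (\<alpha> - 1) / R t ^ 2 * v \<sigma> t
           - v_c / R t ^ 2 * v \<sigma> t * deriv (\<lambda>s. v s t) \<sigma> = 0)"

type_synonym grid_fun = "int \<Rightarrow> real"

definition periodic_grid :: "nat \<Rightarrow> grid_fun set" where
  "periodic_grid J = {V. \<forall>i. V (i + int J) = V i}"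

definition grid_norm :: "nat \<Rightarrow> grid_fun \<Rightarrow> real" where
  "grid_norm J V = sqrt (2 * pi / real J * (\<Sum>i = 1..int J. (V i)\<^sup>2))"

definition lap :: "real \<Rightarrow> grid_fun \<Rightarrow> grid_fun" where
  "lap h V = (\<lambda>i. (V (i - 1) - 2 * V i + V (i + 1)) / h\<^sup>2)"

text \<open>The operator \<open>L_h^m\<close>, with \<open>r\<close> standing for the radius \<open>R_m = R (m k)\<close>.\<close>
definition lin_op :: "real \<Rightarrow> real \<Rightarrow> real \<Rightarrow> real \<Rightarrow> grid_fun \<Rightarrow> grid_fun" where
  "lin_op \<delta> \<alpha> r h V = (\<lambda>i.
     \<delta> / r ^ 4 * lap h (lap h V) i
     + 1 / r ^ 2 * (\<alpha> - 1 + \<delta> / r ^ 2) * lap h V i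
     + (\<alpha> - 1) / r ^ 2 * V i)"

definition phi :: "grid_fun \<Rightarrow> grid_fun \<Rightarrow> grid_fun" where
  "phi V W = (\<lambda>i. (V (i - 1) + V i + V (i + 1)) * (W (i + 1) - W (i - 1)))"

definition psi :: "grid_fun \<Rightarrow> grid_fun \<Rightarrow> grid_fun" where
  "psi V W = (\<lambda>i.
     - (2 * V (i - 1) + V i) * W (i - 1)
     + (V (i + 1) - V (i - 1)) * W i
     + (2 * V (i + 1) + V i) * W (i + 1))"

definition first_step ::
  "real \<Rightarrow> real \<Rightarrow> real \<Rightarrow> (real \<Rightarrow> real) \<Rightarrow> real \<Rightarrow> real \<Rightarrow> grid_fun \<Rightarrow> grid_fun \<Rightarrow> bool" where
  "first_step \<delta> \<alpha> v_c R h k V0 V1 \<longleftrightarrow>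
     (let r = R (1 / 2 * k) in
      \<forall>i. 1 / k * (V1 i - V0 i) + 1 / 2 * lin_op \<delta> \<alpha> r h (\<lambda>l. V1 l + V0 l) i
          = v_c / (6 * h * r\<^sup>2) * phi V0 V0 i)"

text \<open>
  One linear solve within time step \<open>n\<close>: \<open>Vn\<close> is \<open>V^n\<close>, \<open>Vh\<close> the extrapolated value,
  \<open>W\<close> the current iterate and \<open>W'\<close> the next one.
\<close>
definition newton_iterate ::
  "real \<Rightarrow> real \<Rightarrow> real \<Rightarrow> (real \<Rightarrow> real) \<Rightarrow> real \<Rightarrow> real \<Rightarrow> nat
     \<Rightarrow> grid_fun \<Rightarrow> grid_fun \<Rightarrow> grid_fun \<Rightarrow> grid_fun \<Rightarrow> bool" where
  "newton_iterate \<delta> \<alpha> v_c R h k n Vn Vh W W' \<longleftrightarrow>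
     (let r = R ((real n + 1 / 2) * k); U = (\<lambda>l. Vn l + Vh l) in
      \<forall>i. 1 / k * (W' i - Vn i) + 1 / 2 * lin_op \<delta> \<alpha> r h (\<lambda>l. W' l + Vn l) i
          = v_c / (24 * h * r\<^sup>2) * (psi U (\<lambda>l. W l - Vh l) i + phi U U i))"

text \<open>
  \<open>j m\<close> is the number of iterations used to compute \<open>V m\<close>, \<open>2 \<le> m \<le> N\<close>.
\<close>
definition newton_scheme ::
  "real \<Rightarrow> real \<Rightarrow> real \<Rightarrow> (real \<Rightarrow> real) \<Rightarrow> real \<Rightarrow> nat \<Rightarrow> nat \<Rightarrow> (nat \<Rightarrow> nat)
     \<Rightarrow> grid_fun \<Rightarrow> (nat \<Rightarrow> grid_fun) \<Rightarrow> bool" where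
  "newton_scheme \<delta> \<alpha> v_c R T J N j v0 V \<longleftrightarrow>
     (let h = 2 * pi / real J; k = T / real N in
      (\<forall>n\<le>N. V n \<in> periodic_grid J) \<and>
      V 0 = v0 \<and>
      first_step \<delta> \<alpha> v_c R h k (V 0) (V 1) \<and>
      (\<forall>n\<in>{1..<N}. \<exists>W :: nat \<Rightarrow> grid_fun.
         let Vh = (\<lambda>i. 2 * V n i - V (n - 1) i) in
         (\<forall>l\<le>j (n + 1). W l \<in> periodic_grid J) \<and>
         W 0 = Vh \<and>
         (\<forall>l<j (n + 1). newton_iterate \<delta> \<alpha> v_c R h k n (V n) Vh (W l) (W (l + 1))) \<and>
         V (n + 1) = W (j (n + 1))))"

definition grid_values :: "(real \<Rightarrow> real \<Rightarrow> real) \<Rightarrow> real \<Rightarrow> real \<Rightarrow> nat \<Rightarrow> grid_fun" where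
  "grid_values v h k n = (\<lambda>i. v (of_int i * h) (real n * k))"

end

theory Submission
  imports Defs
begin

text \<open>
  The energy method. Testing the error equation of one linear solve with the sum of the new and
  the old error, the fourth-order term \<open>\<delta> / r ^ 4 * lap (lap X)\<close> produces a positive multiple of
  the squared norm of \<open>lap X\<close>, which dominates all first differences of \<open>X\<close>. Since the
  nonlinearity is in divergence form, summation by parts puts its only difference quotient on
  \<open>X\<close>, so it is controlled as soon as the errors are bounded in the maximum norm. Hence each
  iterate satisfies, with errors \<open>a\<close>, \<open>b\<close> of the two previous time levels,
  \<open>x' \<le> a + C * k * (x + x' + a + b + \<rho>)\<close> for squared norms, which is contractive for small
  \<open>k\<close> and gives a bound \<open>a + C' * k * (a + b + \<rho>)\<close> uniformly in the number \<open>\<ge> 1\<close> of iterations;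
  a discrete Gronwall argument concludes. The maximum norm bound is part of the induction: by the
  inverse inequality it is at most \<open>h powr (- 1 / 2)\<close> times the discrete norm, that is, of order
  \<open>h powr (- 1 / 2) * (k\<^sup>2 + h\<^sup>2)\<close>, which tends to zero exactly because \<open>k = o(h powr (1 / 4))\<close>.
\<close>

section \<open>Periodic grid functions\<close>

text \<open>The obstacle is that the energy estimate wants maximum norm bounds for the computed
  quantities before they are known. It is avoided because each solve treats the nonlinearity as
  linear in the current iterate, with coefficient \<open>U = Vn + Vh\<close> built from the two
  previous levels. Pointwise bounds are thus asked only of errors at levels already treated, never
  of the iterates, and the crude bound 1 is enough; it enters the constants through
  \<open>A\<close>. The remainder \<open>psi \<theta> \<theta> / 2\<close> is handled in the same
  way, one factor \<theta> going into the maximum norm and the other into the discrete norm. The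
  start is the second obstacle: the first step evaluates the nonlinearity at the old time, so its
  truncation error is only of order \<open>k + h\<^sup>2\<close>. It is a single step from zero
  error, however, and a separate estimate recovers the missing factor k.\<close>

definition gip :: "nat \<Rightarrow> grid_fun \<Rightarrow> grid_fun \<Rightarrow> real" where
  "gip J V W = (\<Sum>i = 1..int J. V i * W i)"

abbreviation sq :: "nat \<Rightarrow> grid_fun \<Rightarrow> real" where
  "sq J V \<equiv> gip J V V"

definition fdiff :: "real \<Rightarrow> grid_fun \<Rightarrow> grid_fun" where
  "fdiff h V = (\<lambda>i. (V (i + 1) - V i) / h)"

lemma periodic_gridI: "(\<And>i. V (i + int J) = V i) \<Longrightarrow> V \<in> periodic_grid J"
  by (simp add: periodic_grid_def)

lemma periodic_gridD: "V \<in> periodic_grid J \<Longrightarrow> V (i + int J) = V i"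
  by (simp add: periodic_grid_def)

lemma periodic_grid_shift:
  assumes "V \<in> periodic_grid J"
  shows "(\<lambda>i. V (i + a)) \<in> periodic_grid J" "(\<lambda>i. V (i - a)) \<in> periodic_grid J"
  using periodic_gridD[OF assms, of "_ + a"] periodic_gridD[OF assms, of "_ - a"]
  by (auto intro!: periodic_gridI simp: algebra_simps)

lemma periodic_grid_pointwise:
  assumes "V \<in> periodic_grid J" "W \<in> periodic_grid J"
  shows "(\<lambda>i. f (V i) (W i)) \<in> periodic_grid J"
  using assms by (auto simp: periodic_grid_def)

lemma periodic_grid_lap:
  assumes "V \<in> periodic_grid J"
  shows "lap h V \<in> periodic_grid J"
proof -
  have 1: "V (i + int J - 1) = V (i - 1)" "V (i + int J + 1) = V (i + 1)" for i
    using periodic_gridD[OF assms, of "i - 1"] periodic_gridD[OF assms, of "i + 1"]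
    by (auto simp: algebra_simps)
  show ?thesis unfolding lap_def
    by (rule periodic_gridI) (simp add: 1 periodic_gridD[OF assms])
qed

lemma periodic_grid_bounded:
  assumes "V \<in> periodic_grid J" "1 \<le> J" "\<And>i. i \<in> {1..int J} \<Longrightarrow> \<bar>V i\<bar> \<le> A"
  shows "\<bar>V i\<bar> \<le> A"
proof -
  have up: "V (i + int m * int J) = V i" for i m
  proof (induction m)
    case (Suc m)
    have "V (i + int (Suc m) * int J) = V ((i + int m * int J) + int J)"
      by (simp add: algebra_simps)
    then show ?case using Suc periodic_gridD[OF assms(1)] by simp
  qed simp
  have per: "V (i + q * int J) = V i" for i q
  proof (cases "0 \<le> q")
    case True
    then show ?thesis using up[of i "nat q"] by simp
  next
    case False
    then show ?thesis using up[of "i + q * int J" "nat (- q)"] by (simp add: algebra_simps)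
  qed
  \<comment> \<open>The representative of \<open>i\<close> in \<open>{1..int J}\<close>, the range
    of all sums, rather than in \<open>{0..<int J}\<close>; hence the shift by one before and after
    \<open>mod\<close>.\<close>
  define r where "r = (i - 1) mod int J + 1"
  have J: "0 < int J" using assms(2) by simp
  have "r \<in> {1..int J}"
    using pos_mod_bound[OF J, of "i - 1"] pos_mod_sign[OF J, of "i - 1"] by (auto simp: r_def)
  moreover have "i = r + (i - 1) div int J * int J" by (simp add: r_def)
  then have "V i = V r" using per[of r "(i - 1) div int J"] by simp
  ultimately show ?thesis using assms(3) by simp
qed

lemma sum_periodic_shift:
  assumes "f \<in> periodic_grid J"
  shows "(\<Sum>i = 1..int J. f (i + 1)) = (\<Sum>i = 1..int J. f i)"
proof (cases "J = 0")
  case False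
  have "(\<Sum>i = 1..int J. f (i + 1)) = (\<Sum>i = 2..int J + 1. f i)"
    by (rule sum.reindex_bij_witness[of _ "\<lambda>i. i - 1" "\<lambda>i. i + 1"]) auto
  also have "\<dots> = f (int J + 1) + (\<Sum>i = 2..int J. f i)"
  proof -
    have "{2..int J + 1} = insert (int J + 1) {2..int J}" using False by auto
    then show ?thesis by simp
  qed
  also have "f (int J + 1) = f 1" using periodic_gridD[OF assms, of 1] by (simp add: add.commute)
  also have "f 1 + (\<Sum>i = 2..int J. f i) = (\<Sum>i = 1..int J. f i)"
  proof -
    have "{1..int J} = insert 1 {2..int J}" using False by auto
    then show ?thesis by simp
  qed
  finally show ?thesis .
qed simp

lemma sum_periodic_shift':
  assumes "f \<in> periodic_grid J"
  shows "(\<Sum>i = 1..int J. f (i - 1)) = (\<Sum>i = 1..int J. f i)"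
  using sum_periodic_shift[OF periodic_grid_shift(2)[OF assms, of 1]] by simp

lemma sq_nonneg [simp]: "0 \<le> sq J V"
  by (simp add: gip_def sum_nonneg)

lemma le_sq: "i \<in> {1..int J} \<Longrightarrow> (V i)\<^sup>2 \<le> sq J V"
  unfolding gip_def power2_eq_square
  by (rule member_le_sum[where f = "\<lambda>i. V i * V i"]) auto

lemma sq_le_const:
  assumes "\<And>i. i \<in> {1..int J} \<Longrightarrow> \<bar>V i\<bar> \<le> b"
  shows "sq J V \<le> real J * b\<^sup>2"
proof -
  have "sq J V \<le> (\<Sum>i = 1..int J. b\<^sup>2)"
    unfolding gip_def
  proof (rule sum_mono)
    fix i assume "i \<in> {1..int J}"
    then have "\<bar>V i\<bar>\<^sup>2 \<le> b\<^sup>2" using assms by (intro power_mono) auto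
    then show "V i * V i \<le> b\<^sup>2" by (simp add: power2_eq_square)
  qed
  then show ?thesis by simp
qed

lemma sq_lincomb2:
  "sq J (\<lambda>i. a * V i + b * W i) \<le> 2 * a\<^sup>2 * sq J V + 2 * b\<^sup>2 * sq J W"
proof -
  have "(a * x + b * y) * (a * x + b * y) \<le> 2 * a\<^sup>2 * (x * x) + 2 * b\<^sup>2 * (y * y)" for x y :: real
    using zero_le_power2[of "a * x - b * y"] by (simp add: power2_eq_square algebra_simps)
  then show ?thesis
    unfolding gip_def sum_distrib_left sum.distrib[symmetric] by (intro sum_mono) auto
qed

lemma gip_young:
  assumes "0 < \<eta>"
  shows "gip J V W \<le> \<eta> * sq J V + sq J W / (4 * \<eta>)"
proof -
  have "x * y \<le> \<eta> * (x * x) + (y * y) / (4 * \<eta>)" for x y :: real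
  proof -
    have "0 \<le> (2 * \<eta> * x - y)\<^sup>2 / (4 * \<eta>)" using assms by simp
    also have "\<dots> = \<eta> * (x * x) + (y * y) / (4 * \<eta>) - x * y"
      using assms by (simp add: power2_eq_square field_simps)
    finally show ?thesis by simp
  qed
  then show ?thesis
    unfolding gip_def sum_distrib_left sum_divide_distrib sum.distrib[symmetric]
    by (intro sum_mono) auto
qed

section \<open>Summation by parts and coercivity\<close>

lemma gip_lap_adjoint:
  assumes V: "V \<in> periodic_grid J" and W: "W \<in> periodic_grid J"
  shows "gip J (lap h V) W = gip J V (lap h W)"
proof -
  have "(\<lambda>i. V i * W (i + 1)) \<in> periodic_grid J"
    by (rule periodic_grid_pointwise[OF V periodic_grid_shift(1)[OF W]])
  from sum_periodic_shift'[OF this]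
  have 1: "(\<Sum>i = 1..int J. V (i - 1) * W i) = (\<Sum>i = 1..int J. V i * W (i + 1))"
    by simp
  have "(\<lambda>i. V i * W (i - 1)) \<in> periodic_grid J"
    by (rule periodic_grid_pointwise[OF V periodic_grid_shift(2)[OF W]])
  from sum_periodic_shift[OF this]
  have 2: "(\<Sum>i = 1..int J. V (i + 1) * W i) = (\<Sum>i = 1..int J. V i * W (i - 1))"
    by simp
  have "gip J (lap h V) W =
      ((\<Sum>i = 1..int J. V (i - 1) * W i) - 2 * gip J V W + (\<Sum>i = 1..int J. V (i + 1) * W i)) / h\<^sup>2"
    unfolding gip_def lap_def sum_distrib_left sum_subtractf[symmetric] sum.distrib[symmetric]
      sum_divide_distrib by (intro sum.cong) (auto simp: algebra_simps)
  also have "\<dots> = gip J V (lap h W)" unfolding 1 2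
    unfolding gip_def lap_def sum_distrib_left sum_subtractf[symmetric] sum.distrib[symmetric]
      sum_divide_distrib by (intro sum.cong) (auto simp: algebra_simps)
  finally show ?thesis .
qed

lemma gip_lap_self:
  assumes V: "V \<in> periodic_grid J"
  shows "gip J (lap h V) V = - sq J (fdiff h V)"
proof -
  \<comment> \<open>The summands of \<open>gip J (lap h V) V + sq J (fdiff h V)\<close> are
    \<open>?q i - ?q (i - 1)\<close> over \<open>h\<^sup>2\<close>, so their sum telescopes to zero
    over a period.\<close>
  let ?q = "\<lambda>i. (V (i + 1) - V i) * V (i + 1)"
  have "(\<Sum>i = 1..int J. ?q i) = (\<Sum>i = 1..int J. ?q (i - 1))"
    by (rule sum_periodic_shift'[symmetric])
      (rule periodic_gridI, use periodic_gridD[OF V] periodic_gridD[OF V, of "_ + 1"] in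
        \<open>simp add: algebra_simps\<close>)
  then have eq: "(\<Sum>i = 1..int J. ?q i - ?q (i - 1)) = 0" by (simp add: sum_subtractf)
  have "gip J (lap h V) V + sq J (fdiff h V) = (\<Sum>i = 1..int J. ?q i - ?q (i - 1)) / h\<^sup>2"
    unfolding gip_def lap_def fdiff_def sum.distrib[symmetric] sum_divide_distrib
    by (intro sum.cong refl, cases "h = 0")
      (auto simp: power2_eq_square field_simps)
  then show ?thesis using eq by simp
qed

text \<open>The nonlinearity is conservative: \<open>psi a b\<close> is the difference of a flux, so that after
  summation by parts no difference quotient of \<open>a\<close> or \<open>b\<close> is needed.\<close>
lemma gip_psi_bound:
  assumes a: "a \<in> periodic_grid J" and b: "b \<in> periodic_grid J" and X: "X \<in> periodic_grid J"
    and A: "\<And>i. \<bar>a i\<bar> \<le> A" and h: "0 < h"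
  shows "\<bar>gip J (psi a b) X\<bar> / h \<le> 18 * A\<^sup>2 * sq J b + sq J (fdiff h X) / 2"
proof -
  \<comment> \<open>The flux: \<open>psi a b i = G i - G (i - 1)\<close>. It is symmetric in
    \<open>a\<close> and \<open>b\<close>, since \<open>psi\<close> is the polarization of the
    quadratic form \<open>phi V V\<close>, with \<open>psi V V i = 2 * phi V V i\<close>.\<close>
  define G where "G i = 2 * a (i + 1) * b (i + 1) + 2 * a i * b i + a i * b (i + 1) + a (i + 1) * b i"
    for i
  have per: "f (i + (1 + int J)) = f (i + 1)" "f (i + int J) = f i"
    if "f \<in> periodic_grid J" for f i
    using periodic_gridD[OF that, of i] periodic_gridD[OF that, of "i + 1"]
    by (auto simp: algebra_simps)
  have "(\<Sum>i = 1..int J. G (i - 1) * X i) = (\<Sum>i = 1..int J. G i * X (i + 1))"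
    using sum_periodic_shift'[of "\<lambda>i. G i * X (i + 1)" J]
    by (simp add: periodic_grid_def G_def per[OF a] per[OF b] per[OF X] ac_simps)
  moreover have "gip J (psi a b) X = (\<Sum>i = 1..int J. G i * X i) - (\<Sum>i = 1..int J. G (i - 1) * X i)"
    unfolding gip_def psi_def G_def sum_subtractf[symmetric]
    by (intro sum.cong) (auto simp: algebra_simps)
  ultimately have "gip J (psi a b) X / h = - (\<Sum>i = 1..int J. G i * fdiff h X i)"
    by (simp add: fdiff_def sum_subtractf[symmetric] sum_divide_distrib sum_negf[symmetric]
        algebra_simps diff_divide_distrib)
  then have "\<bar>gip J (psi a b) X\<bar> / h = \<bar>\<Sum>i = 1..int J. G i * fdiff h X i\<bar>"
    using h by (metis abs_divide abs_minus_cancel abs_of_pos)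
  also have "\<dots> \<le> (\<Sum>i = 1..int J. \<bar>G i * fdiff h X i\<bar>)" by (rule sum_abs)
  also have "\<dots> \<le> (\<Sum>i = 1..int J. 9 * A\<^sup>2 * (b i * b i + b (i + 1) * b (i + 1))
      + fdiff h X i * fdiff h X i / 2)"
  proof (rule sum_mono)
    fix i
    define x where "x = \<bar>b i\<bar>"
    define y where "y = \<bar>b (i + 1)\<bar>"
    define z where "z = \<bar>fdiff h X i\<bar>"
    have nn: "0 \<le> x" "0 \<le> y" "0 \<le> z" "0 \<le> A" using A[of 0] by (auto simp: x_def y_def z_def)
    have "\<bar>G i\<bar> \<le> 2 * \<bar>a (i+1)\<bar> * y + 2 * \<bar>a i\<bar> * x + \<bar>a i\<bar> * y + \<bar>a (i+1)\<bar> * x"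
      unfolding G_def x_def y_def
      using abs_triangle_ineq by (simp add: abs_mult[symmetric] mult.assoc)
    also have "\<dots> \<le> 2 * A * y + 2 * A * x + A * y + A * x"
      using A nn by (intro add_mono mult_mono) auto
    finally have G: "\<bar>G i\<bar> \<le> 3 * A * (x + y)" by (simp add: algebra_simps)
    have "\<bar>G i * fdiff h X i\<bar> = \<bar>G i\<bar> * z" by (simp add: abs_mult z_def)
    also have "\<dots> \<le> 3 * A * (x + y) * z" using G nn by (intro mult_right_mono) auto
    also have "\<dots> \<le> ((3 * A * (x + y))\<^sup>2 + z\<^sup>2) / 2"
      using zero_le_power2[of "3 * A * (x + y) - z"]
      by (simp add: power2_eq_square algebra_simps)
    also have "(3 * A * (x + y))\<^sup>2 \<le> (3 * A)\<^sup>2 * (2 * (x\<^sup>2 + y\<^sup>2))"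
      unfolding power_mult_distrib[of "3 * A"]
      using zero_le_power2[of "x - y"]
      by (intro mult_left_mono) (auto simp: power2_eq_square algebra_simps)
    finally show "\<bar>G i * fdiff h X i\<bar> \<le> 9 * A\<^sup>2 * (b i * b i + b (i + 1) * b (i + 1))
      + fdiff h X i * fdiff h X i / 2"
      by (simp add: x_def y_def z_def power2_eq_square algebra_simps)
  qed
  \<comment> \<open>By periodicity the shifted copy of \<open>b\<close> has the same sum of squares,
    which turns 9 into 18.\<close>
  also have "\<dots> = 9 * A\<^sup>2 * (sq J b + sq J b) + sq J (fdiff h X) / 2"
    using sum_periodic_shift[OF periodic_grid_pointwise[OF b b, of "(*)"]]
    by (simp add: gip_def sum.distrib sum_distrib_left[symmetric] sum_divide_distrib[symmetric])
  finally show ?thesis by simp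
qed

text \<open>The interpolation \<open>sq J (fdiff h X) \<le> \<eta> * sq J (lap h X) + sq J X / (4 *
  \<eta>)\<close> lets the fourth-order term pay for any multiple \<mu> of the first differences, on
  top of an antidiffusive second-order term. Signs decide which bounds are assumed: the second-order
  coefficient multiplies a nonpositive form and gets an upper bound, the other two a lower bound.
  \<open>C\<close> depends on \<open>d\<close>, \<open>b\<close>, \<open>g\<close> and \<mu> alone,
  hence neither on the grid nor on the time level.\<close>

lemma lin_op_coercive:
  assumes d: "0 < d" and "0 \<le> b" "0 \<le> g" "0 \<le> \<mu>"
  obtains C where "0 \<le> C" "\<And>\<delta> \<alpha> r h J X. \<lbrakk>X \<in> periodic_grid J; d \<le> \<delta> / r ^ 4;
      1 / r ^ 2 * (\<alpha> - 1 + \<delta> / r ^ 2) \<le> b; - g \<le> (\<alpha> - 1) / r ^ 2\<rbrakk>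
    \<Longrightarrow> \<mu> * sq J (fdiff h X) - C * sq J X \<le> 1 / 2 * gip J (lin_op \<delta> \<alpha> r h X) X"
proof -
  \<comment> \<open>Any positive \<eta> with \<open>2 * (\<mu> + b / 2) * \<eta> \<le> d\<close>
    works; the \<open>+ 1\<close> covers the case that \<mu> and \<open>b\<close> are both zero.
    Half of \<open>b\<close> occurs because the operator enters with the factor 1/2.\<close>
  define \<eta> where "\<eta> = d / (2 * (\<mu> + b / 2) + 1)"
  have \<eta>: "0 < \<eta>" "2 * (\<mu> + b / 2) * \<eta> \<le> d"
  proof -
    have *: "0 < 2 * (\<mu> + b / 2) + 1" using assms by simp
    then show "0 < \<eta>" using d by (simp add: \<eta>_def)
    then show "2 * (\<mu> + b / 2) * \<eta> \<le> d"
      using * unfolding \<eta>_def by (simp add: field_simps)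
  qed
  define q where "q = (\<mu> + b / 2) / (4 * \<eta>)"
  define C where "C = q + g / 2"
  show thesis
  proof (rule that)
    show "0 \<le> C" using assms \<eta> by (simp add: C_def q_def)
    fix \<delta> \<alpha> r h :: real and J :: nat and X
    assume X: "X \<in> periodic_grid J" and 1: "d \<le> \<delta> / r ^ 4"
      and 2: "1 / r ^ 2 * (\<alpha> - 1 + \<delta> / r ^ 2) \<le> b" and 3: "- g \<le> (\<alpha> - 1) / r ^ 2"
    define P where "P = sq J (fdiff h X)"
    define Y where "Y = sq J (lap h X)"
    define S where "S = sq J X"
    have nn: "0 \<le> P" "0 \<le> Y" "0 \<le> S" by (simp_all add: P_def Y_def S_def)
    have "gip J (lin_op \<delta> \<alpha> r h X) X = \<delta> / r ^ 4 * gip J (lap h (lap h X)) X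
        + 1 / r ^ 2 * (\<alpha> - 1 + \<delta> / r ^ 2) * gip J (lap h X) X + (\<alpha> - 1) / r ^ 2 * sq J X"
      unfolding gip_def lin_op_def sum_distrib_left sum.distrib[symmetric]
      by (intro sum.cong refl) (simp only: algebra_simps)
    also have "\<dots> = \<delta> / r ^ 4 * Y - 1 / r ^ 2 * (\<alpha> - 1 + \<delta> / r ^ 2) * P + (\<alpha> - 1) / r ^ 2 * S"
      unfolding gip_lap_adjoint[OF periodic_grid_lap[OF X] X] gip_lap_self[OF X]
      by (simp add: Y_def P_def S_def)
    also have "\<dots> \<ge> d * Y - b * P + - g * S"
      using 1 2 3 nn by (intro add_mono diff_mono mult_right_mono) auto
    finally have L: "d * Y - b * P - g * S \<le> gip J (lin_op \<delta> \<alpha> r h X) X" by simp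
    have "P = gip J (\<lambda>i. - lap h X i) X"
      using gip_lap_self[OF X, of h] by (simp add: P_def gip_def sum_negf)
    also have "\<dots> \<le> \<eta> * Y + S / (4 * \<eta>)"
      using gip_young[OF \<eta>(1), of J "\<lambda>i. - lap h X i" X] by (simp add: Y_def S_def gip_def)
    finally have "(\<mu> + b / 2) * P \<le> (\<mu> + b / 2) * (\<eta> * Y + S / (4 * \<eta>))"
      using assms by (intro mult_left_mono) auto
    also have "\<dots> = (2 * (\<mu> + b / 2) * \<eta>) * Y / 2 + (\<mu> + b / 2) / (4 * \<eta>) * S"
      by (simp add: algebra_simps)
    also have "\<dots> \<le> d * Y / 2 + q * S"
      unfolding q_def using \<eta> nn by (intro add_right_mono divide_right_mono mult_right_mono) auto
    finally have "\<mu> * P - C * S \<le> 1 / 2 * (d * Y - b * P - g * S)"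
      by (simp add: C_def algebra_simps)
    then show "\<mu> * sq J (fdiff h X) - C * sq J X \<le> 1 / 2 * gip J (lin_op \<delta> \<alpha> r h X) X"
      using L unfolding P_def S_def by simp
  qed
qed

text \<open>Tested with \<open>E + e\<close>, the time difference becomes
  \<open>(E - e) * (E + e)\<close>, a difference of squares, while the operator is paired with the
  very function it acts on, so that coercivity applies to the Crank-Nicolson average as a
  whole.\<close>

lemma energy_identity:
  assumes k: "0 < k"
    and eq: "\<And>i. i \<in> {1..int J} \<Longrightarrow>
      1 / k * (E i - e i) + 1 / 2 * lin_op \<delta> \<alpha> r h (\<lambda>l. E l + e l) i = F i"
  shows "sq J E - sq J e = k * (gip J F (\<lambda>l. E l + e l)
      - 1 / 2 * gip J (lin_op \<delta> \<alpha> r h (\<lambda>l. E l + e l)) (\<lambda>l. E l + e l))"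
proof -
  have "sq J E - sq J e = (\<Sum>i = 1..int J. (E i - e i) * (E i + e i))"
    unfolding gip_def sum_subtractf[symmetric] by (intro sum.cong) (auto simp: algebra_simps)
  also have "\<dots> = (\<Sum>i = 1..int J. k * (F i * (E i + e i)
      - 1 / 2 * lin_op \<delta> \<alpha> r h (\<lambda>l. E l + e l) i * (E i + e i)))"
  proof (intro sum.cong refl)
    fix i assume i: "i \<in> {1..int J}"
    define L where "L = 1 / 2 * lin_op \<delta> \<alpha> r h (\<lambda>l. E l + e l) i"
    have "E i - e i = k * (F i - L)"
      using eq[OF i] k by (simp add: L_def field_simps)
    then have "(E i - e i) * (E i + e i) = k * (F i - L) * (E i + e i)" by simp
    then show "(E i - e i) * (E i + e i) = k * (F i * (E i + e i)
      - 1 / 2 * lin_op \<delta> \<alpha> r h (\<lambda>l. E l + e l) i * (E i + e i))"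
      unfolding L_def[symmetric] by (simp add: algebra_simps)
  qed
  finally show ?thesis
    by (simp add: gip_def sum_distrib_left sum_subtractf right_diff_distrib mult.assoc)
qed

section \<open>Consistency\<close>

text \<open>The family \<open>f\<close> is a tower of derivatives with one bound \<open>B\<close>
  for all of them. Each stencil is symmetric or antisymmetric about \<open>x\<close>, so every
  second term cancels and the error is of second order. The four stencils are those of
  \<open>lap\<close>, of the two factors of \<open>phi\<close>, and of \<open>lap\<close> applied
  twice.\<close>

lemma lap_taylor:
  fixes f :: "nat \<Rightarrow> real \<Rightarrow> real"
  assumes S: "convex S"
    and der: "\<And>m y. m < 6 \<Longrightarrow> y \<in> S \<Longrightarrow> (f m has_real_derivative f (Suc m) y) (at y within S)"
    and bd: "\<And>m y. m \<le> 6 \<Longrightarrow> y \<in> S \<Longrightarrow> \<bar>f m y\<bar> \<le> B"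
    and h: "0 < h"
    and mem: "x \<in> S" "x + h \<in> S" "x - h \<in> S"
  shows "\<bar>(f 0 (x - h) - 2 * f 0 x + f 0 (x + h)) / h\<^sup>2 - f 2 x\<bar> \<le> B * h\<^sup>2" (is ?t1)
    and "\<bar>(f 0 (x - h) + f 0 x + f 0 (x + h)) / 3 - f 0 x\<bar> \<le> B * h\<^sup>2" (is ?t2)
    and "\<bar>(f 0 (x + h) - f 0 (x - h)) / (2 * h) - f 1 x\<bar> \<le> B * h\<^sup>2" (is ?t3)
    and "x + 2 * h \<in> S \<Longrightarrow> x - 2 * h \<in> S \<Longrightarrow>
      \<bar>(f 0 (x - 2 * h) - 4 * f 0 (x - h) + 6 * f 0 x - 4 * f 0 (x + h) + f 0 (x + 2 * h)) / h ^ 4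
        - f 4 x\<bar> \<le> 2 * B * h\<^sup>2" (is "_ \<Longrightarrow> _ \<Longrightarrow> ?t4")
proof -
  \<comment> \<open>The remainder bound has \<open>fact n\<close> where the sharp real one has
    \<open>fact (Suc n)\<close>; this affects constants only.\<close>
  have T: "\<bar>f 0 (x + s) - (\<Sum>i\<le>n. f i x * s ^ i / fact i)\<bar> \<le> B * \<bar>s\<bar> ^ (Suc n) / fact n"
    if "n < 6" "x + s \<in> S" for n s
    using field_Taylor[OF S, of n f B x "x + s"] der bd mem(1) that by auto
  have B: "0 \<le> B" using bd[of 0 x] mem by auto
  have hp: "0 < h ^ n" for n using h by simp
  have Bh: "0 \<le> B * h ^ n" for n using B h by simp
  show ?t1
  proof -
    have 1: "\<bar>f 0 (x + h) - (f 0 x + f 1 x * h + f 2 x * h ^ 2 / 2 + f 3 x * h ^ 3 / 6)\<bar> \<le> B * h ^ 4 / 6"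
      using T[of 3 h] mem h by (simp add: eval_nat_numeral)
    have 2: "\<bar>f 0 (x - h) - (f 0 x - f 1 x * h + f 2 x * h ^ 2 / 2 - f 3 x * h ^ 3 / 6)\<bar> \<le> B * h ^ 4 / 6"
      using T[of 3 "- h"] mem h by (simp add: eval_nat_numeral)
    have "\<bar>(f 0 (x - h) - 2 * f 0 x + f 0 (x + h)) - f 2 x * h ^ 2\<bar> \<le> B * h ^ 4"
      using 1 2 Bh[of 4] by linarith
    then have "\<bar>(f 0 (x - h) - 2 * f 0 x + f 0 (x + h)) - f 2 x * h ^ 2\<bar> / h ^ 2 \<le> B * h ^ 4 / h ^ 2"
      using h by (intro divide_right_mono) auto
    also have "B * h ^ 4 / h ^ 2 = B * h ^ 2" using h by (simp add: eval_nat_numeral)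
    also have "\<bar>(f 0 (x - h) - 2 * f 0 x + f 0 (x + h)) - f 2 x * h ^ 2\<bar> / h ^ 2 =
        \<bar>(f 0 (x - h) - 2 * f 0 x + f 0 (x + h)) / h\<^sup>2 - f 2 x\<bar>"
      using h by (simp add: field_simps flip: abs_divide[of _ "h ^ 2", simplified])
    finally show ?thesis .
  qed
  show ?t2
  proof -
    have 1: "\<bar>f 0 (x + h) - (f 0 x + f 1 x * h)\<bar> \<le> B * h ^ 2"
      using T[of 1 h] mem h by (simp add: eval_nat_numeral)
    have 2: "\<bar>f 0 (x - h) - (f 0 x - f 1 x * h)\<bar> \<le> B * h ^ 2"
      using T[of 1 "- h"] mem h by (simp add: eval_nat_numeral)
    show ?thesis using 1 2 Bh[of 2] unfolding abs_le_iff add_divide_distrib by linarith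
  qed
  show ?t3
  proof -
    have 1: "\<bar>f 0 (x + h) - (f 0 x + f 1 x * h + f 2 x * h ^ 2 / 2)\<bar> \<le> B * h ^ 3 / 2"
      using T[of 2 h] mem h by (simp add: eval_nat_numeral)
    have 2: "\<bar>f 0 (x - h) - (f 0 x - f 1 x * h + f 2 x * h ^ 2 / 2)\<bar> \<le> B * h ^ 3 / 2"
      using T[of 2 "- h"] mem h by (simp add: eval_nat_numeral)
    have "\<bar>(f 0 (x + h) - f 0 (x - h)) - f 1 x * (2 * h)\<bar> \<le> B * h ^ 3"
      using 1 2 Bh[of 3] by linarith
    then have "\<bar>(f 0 (x + h) - f 0 (x - h)) - f 1 x * (2 * h)\<bar> / (2 * h) \<le> B * h ^ 3 / (2 * h)"
      using h by (intro divide_right_mono) auto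
    also have "B * h ^ 3 / (2 * h) \<le> B * h ^ 2" using h B by (simp add: eval_nat_numeral)
    also have "\<bar>(f 0 (x + h) - f 0 (x - h)) - f 1 x * (2 * h)\<bar> / (2 * h) =
        \<bar>((f 0 (x + h) - f 0 (x - h)) - f 1 x * (2 * h)) / (2 * h)\<bar>"
      using h by simp
    also have "((f 0 (x + h) - f 0 (x - h)) - f 1 x * (2 * h)) / (2 * h)
        = (f 0 (x + h) - f 0 (x - h)) / (2 * h) - f 1 x"
      using h by (simp add: diff_divide_distrib)
    finally show ?thesis .
  qed
  show ?t4 if mem2: "x + 2 * h \<in> S" "x - 2 * h \<in> S"
  proof -
    have 1: "\<bar>f 0 (x + h) - (f 0 x + f 1 x * h + f 2 x * h ^ 2 / 2 + f 3 x * h ^ 3 / 6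
        + f 4 x * h ^ 4 / 24 + f 5 x * h ^ 5 / 120)\<bar> \<le> B * h ^ 6 / 120"
      using T[of 5 h] mem h by (simp add: eval_nat_numeral)
    have 2: "\<bar>f 0 (x - h) - (f 0 x - f 1 x * h + f 2 x * h ^ 2 / 2 - f 3 x * h ^ 3 / 6
        + f 4 x * h ^ 4 / 24 - f 5 x * h ^ 5 / 120)\<bar> \<le> B * h ^ 6 / 120"
      using T[of 5 "- h"] mem h by (simp add: eval_nat_numeral)
    have 3: "\<bar>f 0 (x + 2 * h) - (f 0 x + 2 * (f 1 x * h) + 2 * (f 2 x * h ^ 2) + 8 * (f 3 x * h ^ 3) / 6
        + 16 * (f 4 x * h ^ 4) / 24 + 32 * (f 5 x * h ^ 5) / 120)\<bar> \<le> 64 * (B * h ^ 6) / 120"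
      using T[of 5 "2 * h"] mem2 h by (simp add: eval_nat_numeral algebra_simps)
    have 4: "\<bar>f 0 (x - 2 * h) - (f 0 x - 2 * (f 1 x * h) + 2 * (f 2 x * h ^ 2) - 8 * (f 3 x * h ^ 3) / 6
        + 16 * (f 4 x * h ^ 4) / 24 - 32 * (f 5 x * h ^ 5) / 120)\<bar> \<le> 64 * (B * h ^ 6) / 120"
      using T[of 5 "- (2 * h)"] mem2 h by (simp add: eval_nat_numeral algebra_simps)
    let ?c = "f 0 (x - 2 * h) - 4 * f 0 (x - h) + 6 * f 0 x - 4 * f 0 (x + h) + f 0 (x + 2 * h)"
    \<comment> \<open>The remainders add up to \<open>2 * 64 + 2 * 4 = 136\<close> over 120,
      slightly more than 1; hence the factor 2.\<close>
    have "\<bar>?c - f 4 x * h ^ 4\<bar> \<le> 2 * (B * h ^ 6)"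
      using 1 2 3 4 Bh[of 6] by linarith
    then have "\<bar>?c - f 4 x * h ^ 4\<bar> / h ^ 4 \<le> 2 * (B * h ^ 6) / h ^ 4"
      using h by (intro divide_right_mono) auto
    also have "2 * (B * h ^ 6) / h ^ 4 = 2 * B * h ^ 2" using h by (simp add: eval_nat_numeral)
    also have "\<bar>?c - f 4 x * h ^ 4\<bar> / h ^ 4 = \<bar>(?c - f 4 x * h ^ 4) / h ^ 4\<bar>"
      using h by simp
    also have "(?c - f 4 x * h ^ 4) / h ^ 4 = ?c / h ^ 4 - f 4 x"
      using h by (simp add: diff_divide_distrib)
    finally show ?thesis .
  qed
qed

lemma lap_lap:
  "lap h (lap h V) i = (V (i - 2) - 4 * V (i - 1) + 6 * V i - 4 * V (i + 1) + V (i + 2)) / h ^ 4"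
  by (cases "h = 0") (simp_all add: lap_def field_simps eval_nat_numeral)

lemma midpoint_taylor:
  fixes w0 w1 w2 w3 :: "real \<Rightarrow> real"
  assumes S: "convex S"
    and d0: "\<And>y. y \<in> S \<Longrightarrow> (w0 has_real_derivative w1 y) (at y within S)"
    and d1: "\<And>y. y \<in> S \<Longrightarrow> (w1 has_real_derivative w2 y) (at y within S)"
    and k: "0 < k"
    and mem: "t \<in> S" "t + k / 2 \<in> S" "t - k / 2 \<in> S"
    and B2: "\<And>y. y \<in> S \<Longrightarrow> \<bar>w2 y\<bar> \<le> B"
  shows "\<bar>(w0 (t + k / 2) + w0 (t - k / 2)) / 2 - w0 t\<bar> \<le> B * k\<^sup>2"
    and "\<lbrakk>\<And>y. y \<in> S \<Longrightarrow> (w2 has_real_derivative w3 y) (at y within S);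
      \<And>y. y \<in> S \<Longrightarrow> \<bar>w3 y\<bar> \<le> B\<rbrakk> \<Longrightarrow> \<bar>(w0 (t + k / 2) - w0 (t - k / 2)) / k - w1 t\<bar> \<le> B * k\<^sup>2"
proof -
  define f where "f = (\<lambda>i::nat. if i = 0 then w0 else if i = 1 then w1 else if i = 2 then w2 else w3)"
  have B: "0 \<le> B" using B2[OF mem(1)] by linarith
  have T1: "\<bar>w0 (t + s) - (w0 t + w1 t * s)\<bar> \<le> B * s\<^sup>2" if "t + s \<in> S" for s
  proof -
    have "(f i has_real_derivative f (Suc i) y) (at y within S)" if "y \<in> S" "i \<le> 1" for y i
      using that d0 d1 by (cases "i = 0") (auto simp: f_def)
    moreover have "norm (f (Suc 1) y) \<le> B" if "y \<in> S" for y
      using B2[OF that] by (simp add: f_def)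
    ultimately have "norm (f 0 (t + s) - (\<Sum>i\<le>1. f i t * (t + s - t) ^ i / fact i))
        \<le> B * norm (t + s - t) ^ Suc 1 / fact 1"
      using field_Taylor[OF S, of 1 f B t "t + s"] mem(1) that by blast
    then show ?thesis by (simp add: f_def power2_eq_square)
  qed
  show "\<bar>(w0 (t + k / 2) + w0 (t - k / 2)) / 2 - w0 t\<bar> \<le> B * k\<^sup>2"
  proof -
    have "\<bar>w0 (t + k / 2) - (w0 t + w1 t * k / 2)\<bar> \<le> B * k\<^sup>2 / 4"
      using T1[of "k / 2"] mem by (simp add: power_divide)
    moreover have "\<bar>w0 (t - k / 2) - (w0 t - w1 t * k / 2)\<bar> \<le> B * k\<^sup>2 / 4"
      using T1[of "- (k / 2)"] mem by (simp add: power_divide)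
    moreover have "0 \<le> B * k\<^sup>2" using B by simp
    ultimately show ?thesis unfolding abs_le_iff add_divide_distrib by linarith
  qed
  show "\<bar>(w0 (t + k / 2) - w0 (t - k / 2)) / k - w1 t\<bar> \<le> B * k\<^sup>2"
    if d2: "\<And>y. y \<in> S \<Longrightarrow> (w2 has_real_derivative w3 y) (at y within S)"
      and B3: "\<And>y. y \<in> S \<Longrightarrow> \<bar>w3 y\<bar> \<le> B"
  proof -
    have T2: "\<bar>w0 (t + s) - (w0 t + w1 t * s + w2 t * s\<^sup>2 / 2)\<bar> \<le> B * \<bar>s\<bar> ^ 3 / 2" if "t + s \<in> S" for s
    proof -
      have "(f i has_real_derivative f (Suc i) y) (at y within S)" if "y \<in> S" "i \<le> 2" for y i
        using that d0 d1 d2 by (cases "i = 0"; cases "i = 1") (auto simp: f_def numeral_2_eq_2)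
      moreover have "norm (f (Suc 2) y) \<le> B" if "y \<in> S" for y
        using B3[OF that] by (simp add: f_def)
      ultimately have "norm (f 0 (t + s) - (\<Sum>i\<le>2. f i t * (t + s - t) ^ i / fact i))
          \<le> B * norm (t + s - t) ^ Suc 2 / fact 2"
        using field_Taylor[OF S, of 2 f B t "t + s"] mem(1) that by blast
      then show ?thesis by (simp add: f_def eval_nat_numeral)
    qed
    have "\<bar>w0 (t + k / 2) - (w0 t + w1 t * k / 2 + w2 t * k\<^sup>2 / 8)\<bar> \<le> B * k ^ 3 / 16"
      using T2[of "k / 2"] mem k by (simp add: power_divide)
    moreover have "\<bar>w0 (t - k / 2) - (w0 t - w1 t * k / 2 + w2 t * k\<^sup>2 / 8)\<bar> \<le> B * k ^ 3 / 16"
      using T2[of "- (k / 2)"] mem k by (simp add: power_divide)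
    moreover have "0 \<le> B * k ^ 3" using B k by simp
    ultimately have "\<bar>(w0 (t + k / 2) - w0 (t - k / 2)) - w1 t * k\<bar> \<le> B * k ^ 3" by linarith
    then have "\<bar>(w0 (t + k / 2) - w0 (t - k / 2)) - w1 t * k\<bar> / k \<le> B * k ^ 3 / k"
      using k by (intro divide_right_mono) auto
    also have "B * k ^ 3 / k = B * k\<^sup>2" using k by (simp add: eval_nat_numeral)
    also have "\<bar>(w0 (t + k / 2) - w0 (t - k / 2)) - w1 t * k\<bar> / k
        = \<bar>((w0 (t + k / 2) - w0 (t - k / 2)) - w1 t * k) / k\<bar>"
      using k by simp
    also have "((w0 (t + k / 2) - w0 (t - k / 2)) - w1 t * k) / k
        = (w0 (t + k / 2) - w0 (t - k / 2)) / k - w1 t"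
      using k by (simp add: diff_divide_distrib)
    finally show ?thesis .
  qed
qed

text \<open>The factor \<open>6 * h\<close> splits as \<open>3 * (2 * h)\<close>: the first factor
  of \<open>phi\<close> becomes a three-point mean and the second a central difference quotient.
  Both are accurate to second order, and the usual splitting of a difference of products combines
  them.\<close>

lemma phi_taylor:
  fixes f :: "nat \<Rightarrow> real \<Rightarrow> real"
  assumes S: "convex S"
    and der: "\<And>m y. m < 6 \<Longrightarrow> y \<in> S \<Longrightarrow> (f m has_real_derivative f (Suc m) y) (at y within S)"
    and bd: "\<And>m y. m \<le> 6 \<Longrightarrow> y \<in> S \<Longrightarrow> \<bar>f m y\<bar> \<le> B"
    and h: "0 < h"
    and mem: "x \<in> S" "x + h \<in> S" "x - h \<in> S"
  shows "\<bar>(f 0 (x - h) + f 0 x + f 0 (x + h)) * (f 0 (x + h) - f 0 (x - h)) / (6 * h) - f 0 x * f 1 x\<bar>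
    \<le> 2 * B\<^sup>2 * h\<^sup>2"
proof -
  define p where "p = (f 0 (x - h) + f 0 x + f 0 (x + h)) / 3"
  define q where "q = (f 0 (x + h) - f 0 (x - h)) / (2 * h)"
  note tay = lap_taylor(2,3)[where f = f and B = B, OF S der bd h mem, folded p_def q_def]
  have B: "0 \<le> B" using bd[of 0 x] mem by auto
  have p: "\<bar>p\<bar> \<le> B" 
    using bd[of 0 x] bd[of 0 "x + h"] bd[of 0 "x - h"] mem unfolding p_def add_divide_distrib abs_le_iff by auto
  have f1: "\<bar>f 1 x\<bar> \<le> B" using bd[of 1] mem by simp
  have "(f 0 (x - h) + f 0 x + f 0 (x + h)) * (f 0 (x + h) - f 0 (x - h)) / (6 * h) = p * q"
    by (simp add: p_def q_def)
  also have "p * q - f 0 x * f 1 x = p * (q - f 1 x) + (p - f 0 x) * f 1 x"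
    by (simp add: algebra_simps)
  also have "\<bar>\<dots>\<bar> \<le> \<bar>p\<bar> * \<bar>q - f 1 x\<bar> + \<bar>p - f 0 x\<bar> * \<bar>f 1 x\<bar>"
    by (metis abs_mult abs_triangle_ineq)
  also have "\<dots> \<le> B * (B * h\<^sup>2) + (B * h\<^sup>2) * B"
    using p f1 tay B by (intro add_mono mult_mono) auto
  finally show ?thesis by (simp add: power2_eq_square algebra_simps)
qed

section \<open>Derivatives on the strip and their uniform bounds\<close>

lemma Cp_strip_continuous:
  "Cp_strip p T v \<Longrightarrow> continuous_on (UNIV \<times> {0..T}) (\<lambda>(\<sigma>, t). v \<sigma> t)"
  by (cases p) auto

lemma Cp_strip_bounded:
  assumes "Cp_strip p T v"
  shows "\<exists>B. \<forall>\<sigma>\<in>{a..b}. \<forall>t\<in>{0..T}. \<bar>v \<sigma> t\<bar> \<le> B"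
proof -
  have "compact ((\<lambda>(\<sigma>, t). v \<sigma> t) ` ({a..b} \<times> {0..T}))"
    by (intro compact_continuous_image compact_Times compact_Icc
        continuous_on_subset[OF Cp_strip_continuous[OF assms]]) auto
  then obtain B where "\<forall>y\<in>(\<lambda>(\<sigma>, t). v \<sigma> t) ` ({a..b} \<times> {0..T}). norm y \<le> B"
    using compact_imp_bounded bounded_iff by blast
  then show ?thesis by (intro exI[of _ B]) auto
qed

lemma Cp_strip_bounded_family:
  assumes "\<And>m. m \<le> (n::nat) \<Longrightarrow> Cp_strip (p m) T (D m)"
  obtains B where "0 \<le> B"
    "\<And>m \<sigma> t. m \<le> n \<Longrightarrow> \<sigma> \<in> {a..b} \<Longrightarrow> t \<in> {0..T} \<Longrightarrow> \<bar>D m \<sigma> t\<bar> \<le> B"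
proof -
  have "\<forall>m\<in>{..n}. \<exists>B. \<forall>\<sigma>\<in>{a..b}. \<forall>t\<in>{0..T}. \<bar>D m \<sigma> t\<bar> \<le> B"
    using assms Cp_strip_bounded by blast
  then obtain b' where b': "\<And>m \<sigma> t. m \<le> n \<Longrightarrow> \<sigma> \<in> {a..b} \<Longrightarrow> t \<in> {0..T} \<Longrightarrow> \<bar>D m \<sigma> t\<bar> \<le> b' m"
    by (metis atMost_iff bchoice)
  show thesis
  proof (rule that[of "\<Sum>m\<le>n. \<bar>b' m\<bar>"])
    fix m \<sigma> t assume *: "m \<le> n" "\<sigma> \<in> {a..b}" "t \<in> {0..T}"
    have "\<bar>D m \<sigma> t\<bar> \<le> \<bar>b' m\<bar>" using b'[OF *] by linarith
    also have "\<dots> \<le> (\<Sum>m\<le>n. \<bar>b' m\<bar>)"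
      using * by (intro member_le_sum) auto
    finally show "\<bar>D m \<sigma> t\<bar> \<le> (\<Sum>m\<le>n. \<bar>b' m\<bar>)" .
  qed (simp add: sum_nonneg)
qed

text \<open>\<open>Cp_strip\<close> hides derivatives behind nested existential quantifiers. This
  fixes one coherent tower in \<sigma>, together with the smoothness left at each stage.\<close>

lemma Cp_strip_space_derivs:
  assumes "Cp_strip n T v"
  shows "\<exists>D. D 0 = v \<and> (\<forall>m\<le>n. Cp_strip (n - m) T (D m)) \<and>
    (\<forall>m<n. \<forall>\<sigma>. \<forall>t\<in>{0..T}. ((\<lambda>s. D m s t) has_real_derivative D (Suc m) \<sigma> t) (at \<sigma>))"
  using assms
proof (induction n arbitrary: v)
  case 0
  then show ?case by (intro exI[of _ "\<lambda>_. v"]) simp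
next
  case (Suc n)
  from Suc.prems obtain v\<sigma> where
    v: "\<And>\<sigma> t. t \<in> {0..T} \<Longrightarrow> ((\<lambda>s. v s t) has_real_derivative v\<sigma> \<sigma> t) (at \<sigma>)"
    and "Cp_strip n T v\<sigma>"
    unfolding Cp_strip.simps by blast
  from Suc.IH[OF this(2)] obtain D where D: "D 0 = v\<sigma>" "\<forall>m\<le>n. Cp_strip (n - m) T (D m)"
    "\<forall>m<n. \<forall>\<sigma>. \<forall>t\<in>{0..T}. ((\<lambda>s. D m s t) has_real_derivative D (Suc m) \<sigma> t) (at \<sigma>)"
    by blast
  show ?case
  proof (intro exI[of _ "case_nat v D"] conjI allI impI ballI)
    show "Cp_strip (Suc n - m) T (case_nat v D m)" if "m \<le> Suc n" for m
      using that D(2) Suc.prems by (cases m) (auto simp del: Cp_strip.simps)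
    show "((\<lambda>s. case_nat v D m s t) has_real_derivative case_nat v D (Suc m) \<sigma> t) (at \<sigma>)"
      if "m < Suc n" "t \<in> {0..T}" for m \<sigma> t
      using that D(1,3) v by (cases m) auto
  qed simp
qed

lemma Cp_strip_time_derivs:
  assumes "Cp_strip (Suc (Suc q)) T v"
  shows "\<exists>A E. (\<forall>\<sigma>. \<forall>t\<in>{0..T}. ((\<lambda>\<tau>. v \<sigma> \<tau>) has_real_derivative A \<sigma> t) (at t within {0..T}) \<and>
      ((\<lambda>\<tau>. A \<sigma> \<tau>) has_real_derivative E \<sigma> t) (at t within {0..T})) \<and>
    Cp_strip (Suc q) T A \<and> Cp_strip q T E"
proof -
  obtain A where A: "\<forall>\<sigma>. \<forall>t\<in>{0..T}. ((\<lambda>\<tau>. v \<sigma> \<tau>) has_real_derivative A \<sigma> t) (at t within {0..T})"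
    "Cp_strip (Suc q) T A"
    using assms unfolding Cp_strip.simps(2)[of "Suc q"] by metis
  then obtain E where "\<forall>\<sigma>. \<forall>t\<in>{0..T}. ((\<lambda>\<tau>. A \<sigma> \<tau>) has_real_derivative E \<sigma> t) (at t within {0..T})"
    "Cp_strip q T E"
    unfolding Cp_strip.simps(2)[of q] by metis
  with A show ?thesis by blast
qed

lemma deriv_funpow:
  assumes "D 0 = f" "\<And>m s. m < n \<Longrightarrow> (D m has_real_derivative D (Suc m) s) (at s)" "m \<le> n"
  shows "(deriv ^^ m) f = D m"
  using assms(3)
proof (induction m)
  case 0
  then show ?case using assms(1) by simp
next
  case (Suc m)
  then have "deriv (D m) s = D (Suc m) s" for s
    using assms(2)[of m s] by (intro DERIV_imp_deriv) auto
  then show ?case using Suc by auto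
qed

lemma coefficients_bounded:
  fixes \<delta> \<alpha> v_c r0 :: real
  assumes r0: "0 < r0"
  obtains C where "0 \<le> C" "\<And>r. r0 \<le> r \<Longrightarrow> \<bar>\<delta> / r ^ 4\<bar> \<le> C"
    "\<And>r. r0 \<le> r \<Longrightarrow> \<bar>1 / r ^ 2 * (\<alpha> - 1 + \<delta> / r ^ 2)\<bar> \<le> C"
    "\<And>r. r0 \<le> r \<Longrightarrow> \<bar>(\<alpha> - 1) / r ^ 2\<bar> \<le> C"
    "\<And>r. r0 \<le> r \<Longrightarrow> \<bar>v_c / r ^ 2\<bar> \<le> C"
proof -
  have b: "\<bar>a / r ^ n\<bar> \<le> \<bar>a\<bar> / r0 ^ n" if "r0 \<le> r" for a r :: real and n
    using that r0 by (auto simp: abs_divide power_abs intro!: divide_left_mono power_mono mult_pos_pos)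
  define C2 where "C2 = (\<bar>\<alpha> - 1\<bar> + \<bar>\<delta>\<bar> / r0\<^sup>2) / r0\<^sup>2"
  have c2: "\<bar>1 / r ^ 2 * (\<alpha> - 1 + \<delta> / r ^ 2)\<bar> \<le> C2" if "r0 \<le> r" for r
  proof -
    have "\<bar>1 / r ^ 2 * (\<alpha> - 1 + \<delta> / r ^ 2)\<bar> = \<bar>(\<alpha> - 1 + \<delta> / r ^ 2) / r ^ 2\<bar>" by simp
    also have "\<dots> \<le> \<bar>\<alpha> - 1 + \<delta> / r ^ 2\<bar> / r0\<^sup>2" by (rule b[OF that])
    also have "\<dots> \<le> C2"
      unfolding C2_def using b[OF that, of \<delta> 2] abs_triangle_ineq[of "\<alpha> - 1" "\<delta> / r\<^sup>2"]
      by (intro divide_right_mono) (linarith, simp)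
    finally show ?thesis .
  qed
  have nn: "0 \<le> C2" "0 \<le> \<bar>\<delta>\<bar> / r0 ^ 4" "0 \<le> \<bar>\<alpha> - 1\<bar> / r0\<^sup>2" "0 \<le> \<bar>v_c\<bar> / r0\<^sup>2"
    using r0 by (auto simp: C2_def)
  show thesis
  proof (rule that[of "\<bar>\<delta>\<bar> / r0 ^ 4 + C2 + \<bar>\<alpha> - 1\<bar> / r0\<^sup>2 + \<bar>v_c\<bar> / r0\<^sup>2"])
    fix r assume r: "r0 \<le> r"
    show "\<bar>\<delta> / r ^ 4\<bar> \<le> \<bar>\<delta>\<bar> / r0 ^ 4 + C2 + \<bar>\<alpha> - 1\<bar> / r0\<^sup>2 + \<bar>v_c\<bar> / r0\<^sup>2"
      using b[OF r, of \<delta> 4] nn by linarith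
    show "\<bar>1 / r ^ 2 * (\<alpha> - 1 + \<delta> / r ^ 2)\<bar> \<le> \<bar>\<delta>\<bar> / r0 ^ 4 + C2 + \<bar>\<alpha> - 1\<bar> / r0\<^sup>2 + \<bar>v_c\<bar> / r0\<^sup>2"
      using c2[OF r] nn by linarith
    show "\<bar>(\<alpha> - 1) / r ^ 2\<bar> \<le> \<bar>\<delta>\<bar> / r0 ^ 4 + C2 + \<bar>\<alpha> - 1\<bar> / r0\<^sup>2 + \<bar>v_c\<bar> / r0\<^sup>2"
      using b[OF r, of "\<alpha> - 1" 2] nn by linarith
    show "\<bar>v_c / r ^ 2\<bar> \<le> \<bar>\<delta>\<bar> / r0 ^ 4 + C2 + \<bar>\<alpha> - 1\<bar> / r0\<^sup>2 + \<bar>v_c\<bar> / r0\<^sup>2"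
      using b[OF r, of v_c 2] nn by linarith
  qed (use nn in linarith)
qed

text \<open>The origin of the regularity 6: the fourth difference quotient is second-order accurate
  at the price of six \<sigma>-derivatives, and averaging \<open>D 4\<close> over a time step takes
  two time derivatives on top of four spatial ones. \<open>A m\<close> and \<open>E m\<close> are
  the first and second time derivatives of \<open>D m\<close>, so space is always differentiated
  before time; \<open>G\<close> is the third time derivative of \<open>v\<close>.\<close>

lemma smooth_strip_derivs:
  assumes "Cp_strip 6 T v"
  obtains D A E :: "nat \<Rightarrow> real \<Rightarrow> real \<Rightarrow> real" and G :: "real \<Rightarrow> real \<Rightarrow> real" and B :: real where
    "D 0 = v"
    "\<And>m \<sigma> t. m < 6 \<Longrightarrow> t \<in> {0..T} \<Longrightarrow> ((\<lambda>s. D m s t) has_real_derivative D (Suc m) \<sigma> t) (at \<sigma>)"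
    "\<And>m \<sigma> t. m \<le> 4 \<Longrightarrow> t \<in> {0..T} \<Longrightarrow> ((\<lambda>\<tau>. D m \<sigma> \<tau>) has_real_derivative A m \<sigma> t) (at t within {0..T})"
    "\<And>m \<sigma> t. m \<le> 4 \<Longrightarrow> t \<in> {0..T} \<Longrightarrow> ((\<lambda>\<tau>. A m \<sigma> \<tau>) has_real_derivative E m \<sigma> t) (at t within {0..T})"
    "\<And>\<sigma> t. t \<in> {0..T} \<Longrightarrow> ((\<lambda>\<tau>. E 0 \<sigma> \<tau>) has_real_derivative G \<sigma> t) (at t within {0..T})"
    "0 \<le> B"
    "\<And>m \<sigma> t. m \<le> 6 \<Longrightarrow> \<sigma> \<in> {a..b} \<Longrightarrow> t \<in> {0..T} \<Longrightarrow> \<bar>D m \<sigma> t\<bar> \<le> B"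
    "\<And>m \<sigma> t. m \<le> 4 \<Longrightarrow> \<sigma> \<in> {a..b} \<Longrightarrow> t \<in> {0..T} \<Longrightarrow> \<bar>A m \<sigma> t\<bar> \<le> B"
    "\<And>m \<sigma> t. m \<le> 4 \<Longrightarrow> \<sigma> \<in> {a..b} \<Longrightarrow> t \<in> {0..T} \<Longrightarrow> \<bar>E m \<sigma> t\<bar> \<le> B"
    "\<And>\<sigma> t. \<sigma> \<in> {a..b} \<Longrightarrow> t \<in> {0..T} \<Longrightarrow> \<bar>G \<sigma> t\<bar> \<le> B"
proof -
  obtain D where D: "D 0 = v" "\<And>m. m \<le> 6 \<Longrightarrow> Cp_strip (6 - m) T (D m)"
    "\<And>m \<sigma> t. m < 6 \<Longrightarrow> t \<in> {0..T} \<Longrightarrow> ((\<lambda>s. D m s t) has_real_derivative D (Suc m) \<sigma> t) (at \<sigma>)"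
    using Cp_strip_space_derivs[OF assms] by blast
  have "\<forall>m\<in>{..4}. \<exists>A E. (\<forall>\<sigma>. \<forall>t\<in>{0..T}. ((\<lambda>\<tau>. D m \<sigma> \<tau>) has_real_derivative A \<sigma> t) (at t within {0..T}) \<and>
      ((\<lambda>\<tau>. A \<sigma> \<tau>) has_real_derivative E \<sigma> t) (at t within {0..T})) \<and>
    Cp_strip (Suc (4 - m)) T A \<and> Cp_strip (4 - m) T E"
  proof
    fix m :: nat assume "m \<in> {..4}"
    then have "6 - m = Suc (Suc (4 - m))" "m \<le> 6" by auto
    with D(2)[of m] show "\<exists>A E. (\<forall>\<sigma>. \<forall>t\<in>{0..T}. ((\<lambda>\<tau>. D m \<sigma> \<tau>) has_real_derivative A \<sigma> t) (at t within {0..T}) \<and>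
        ((\<lambda>\<tau>. A \<sigma> \<tau>) has_real_derivative E \<sigma> t) (at t within {0..T})) \<and>
      Cp_strip (Suc (4 - m)) T A \<and> Cp_strip (4 - m) T E"
      by (intro Cp_strip_time_derivs) simp
  qed
  then obtain A E where AE: "\<forall>m\<in>{..4}. (\<forall>\<sigma>. \<forall>t\<in>{0..T}.
      ((\<lambda>\<tau>. D m \<sigma> \<tau>) has_real_derivative A m \<sigma> t) (at t within {0..T}) \<and>
      ((\<lambda>\<tau>. A m \<sigma> \<tau>) has_real_derivative E m \<sigma> t) (at t within {0..T})) \<and>
    Cp_strip (Suc (4 - m)) T (A m) \<and> Cp_strip (4 - m) T (E m)"
    unfolding bchoice_iff by blast
  then have "Cp_strip (4 - 0) T (E 0)" by blast
  then have "Cp_strip (Suc 3) T (E 0)" by (simp del: Cp_strip.simps add: numeral_eq_Suc)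
  then obtain G where G: "\<And>\<sigma> t. t \<in> {0..T} \<Longrightarrow> ((\<lambda>\<tau>. E 0 \<sigma> \<tau>) has_real_derivative G \<sigma> t) (at t within {0..T})"
    "Cp_strip 3 T G"
    unfolding Cp_strip.simps(2)[of 3] by metis
  obtain B1 where B1: "0 \<le> B1" "\<And>m \<sigma> t. m \<le> 6 \<Longrightarrow> \<sigma> \<in> {a..b} \<Longrightarrow> t \<in> {0..T} \<Longrightarrow> \<bar>D m \<sigma> t\<bar> \<le> B1"
    using Cp_strip_bounded_family[of 6 "\<lambda>m. 6 - m" T D a b] D(2) by metis
  obtain B2 where B2: "0 \<le> B2" "\<And>m \<sigma> t. m \<le> 4 \<Longrightarrow> \<sigma> \<in> {a..b} \<Longrightarrow> t \<in> {0..T} \<Longrightarrow> \<bar>A m \<sigma> t\<bar> \<le> B2"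
    using Cp_strip_bounded_family[of 4 "\<lambda>m. Suc (4 - m)" T A a b] AE by (metis atMost_iff)
  obtain B3 where B3: "0 \<le> B3" "\<And>m \<sigma> t. m \<le> 4 \<Longrightarrow> \<sigma> \<in> {a..b} \<Longrightarrow> t \<in> {0..T} \<Longrightarrow> \<bar>E m \<sigma> t\<bar> \<le> B3"
    using Cp_strip_bounded_family[of 4 "\<lambda>m. 4 - m" T E a b] AE by (metis atMost_iff)
  obtain B4 where B4: "0 \<le> B4" "\<And>\<sigma> t. \<sigma> \<in> {a..b} \<Longrightarrow> t \<in> {0..T} \<Longrightarrow> \<bar>G \<sigma> t\<bar> \<le> B4"
    using Cp_strip_bounded_family[of 0 "\<lambda>_. 3" T "\<lambda>_. G" a b] G(2) by (metis le0)
  show thesis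
  proof (rule that[of D A E G "B1 + B2 + B3 + B4"])
    fix m :: nat and \<sigma> t :: real
    assume st: "\<sigma> \<in> {a..b}" "t \<in> {0..T}"
    show "\<bar>D m \<sigma> t\<bar> \<le> B1 + B2 + B3 + B4" if "m \<le> 6"
      using B1(2)[OF that st] B1 B2 B3 B4 by linarith
    show "\<bar>A m \<sigma> t\<bar> \<le> B1 + B2 + B3 + B4" if "m \<le> 4"
      using B2(2)[OF that st] B1 B2 B3 B4 by linarith
    show "\<bar>E m \<sigma> t\<bar> \<le> B1 + B2 + B3 + B4" if "m \<le> 4"
      using B3(2)[OF that st] B1 B2 B3 B4 by linarith
    show "\<bar>G \<sigma> t\<bar> \<le> B1 + B2 + B3 + B4"
      using B4(2)[OF st] B1 B2 B3 B4 by linarith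
  next
    fix m :: nat and \<sigma> t :: real
    assume t: "t \<in> {0..T}"
    show "((\<lambda>s. D m s t) has_real_derivative D (Suc m) \<sigma> t) (at \<sigma>)" if "m < 6"
      using D(3)[OF that t] .
    show "((\<lambda>\<tau>. D m \<sigma> \<tau>) has_real_derivative A m \<sigma> t) (at t within {0..T})" if "m \<le> 4"
      using AE that t by blast
    show "((\<lambda>\<tau>. A m \<sigma> \<tau>) has_real_derivative E m \<sigma> t) (at t within {0..T})" if "m \<le> 4"
      using AE that t by blast
    show "((\<lambda>\<tau>. E 0 \<sigma> \<tau>) has_real_derivative G \<sigma> t) (at t within {0..T})"
      using G(1)[OF t] .
  next
    show "0 \<le> B1 + B2 + B3 + B4" using B1(1) B2(1) B3(1) B4(1) by linarith
  qed (rule D(1))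
qed

text \<open>Everything is centred at \<open>t\<close>, the midpoint of a time step, so that averages
  and differences over the step err by order \<open>k\<^sup>2\<close> only. In the last bound the
  nonlinearity sits at the left end \<open>t - k / 2\<close>, which costs one order in
  \<open>k\<close>. The bound on the second time difference is the error of the extrapolation
  \<open>2 * V n - V (n - 1)\<close> when fed with the exact solution.\<close>

lemma consistency:
  fixes \<delta> \<alpha> v_c T r0 :: real
  assumes T: "0 < T" and smooth: "Cp_strip 6 T v" and pde: "solves_pde \<delta> \<alpha> v_c T R v"
    and r0: "0 < r0" "\<And>t. t \<in> {0..T} \<Longrightarrow> r0 \<le> R t"
  obtains B where "0 \<le> B"
    "\<And>\<sigma> t. \<sigma> \<in> {0..2 * pi} \<Longrightarrow> t \<in> {0..T} \<Longrightarrow> \<bar>v \<sigma> t\<bar> \<le> B"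
    "\<And>\<sigma> t k. \<lbrakk>\<sigma> \<in> {0..2 * pi}; 0 < k; 0 \<le> t - k; t + k \<le> T\<rbrakk>
      \<Longrightarrow> \<bar>v \<sigma> (t + k) - 2 * v \<sigma> t + v \<sigma> (t - k)\<bar> \<le> B * k\<^sup>2"
    "\<And>h k t i V0 V1. \<lbrakk>0 < h; h \<le> 2 * pi; 0 < k; 0 \<le> t - k / 2; t + k / 2 \<le> T;
        of_int i * h \<in> {0..2 * pi};
        V0 = (\<lambda>l. v (of_int l * h) (t - k / 2)); V1 = (\<lambda>l. v (of_int l * h) (t + k / 2))\<rbrakk>
      \<Longrightarrow> \<bar>1 / k * (V1 i - V0 i) + 1 / 2 * lin_op \<delta> \<alpha> (R t) h (\<lambda>l. V1 l + V0 l) i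
          - v_c / (24 * h * (R t)\<^sup>2) * phi (\<lambda>l. V1 l + V0 l) (\<lambda>l. V1 l + V0 l) i\<bar> \<le> B * (k\<^sup>2 + h\<^sup>2)"
    "\<And>h k t i V0 V1. \<lbrakk>0 < h; h \<le> 2 * pi; 0 < k; k \<le> 1; 0 \<le> t - k / 2; t + k / 2 \<le> T;
        of_int i * h \<in> {0..2 * pi};
        V0 = (\<lambda>l. v (of_int l * h) (t - k / 2)); V1 = (\<lambda>l. v (of_int l * h) (t + k / 2))\<rbrakk>
      \<Longrightarrow> \<bar>1 / k * (V1 i - V0 i) + 1 / 2 * lin_op \<delta> \<alpha> (R t) h (\<lambda>l. V1 l + V0 l) i
          - v_c / (6 * h * (R t)\<^sup>2) * phi V0 V0 i\<bar> \<le> B * (k + h\<^sup>2)"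
proof -
  \<comment> \<open>For \<sigma> in \<open>{0..2 * pi}\<close> and \<open>h \<le> 2 * pi\<close>,
    the five-point stencil from \<open>\<sigma> - 2 * h\<close> to \<open>\<sigma> + 2 * h\<close>
    stays between these two numbers.\<close>
  define a b where "a = - 4 * pi" and "b = 6 * pi"
  have sub: "{0..2 * pi} \<subseteq> {a..b}" by (auto simp: a_def b_def)
  obtain D A E :: "nat \<Rightarrow> real \<Rightarrow> real \<Rightarrow> real" and G :: "real \<Rightarrow> real \<Rightarrow> real" and B :: real where
    D0: "D 0 = v" and
    D: "\<And>m \<sigma> t. m < 6 \<Longrightarrow> t \<in> {0..T} \<Longrightarrow> ((\<lambda>s. D m s t) has_real_derivative D (Suc m) \<sigma> t) (at \<sigma>)" and
    A: "\<And>m \<sigma> t. m \<le> 4 \<Longrightarrow> t \<in> {0..T} \<Longrightarrow> ((\<lambda>\<tau>. D m \<sigma> \<tau>) has_real_derivative A m \<sigma> t) (at t within {0..T})" and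
    E: "\<And>m \<sigma> t. m \<le> 4 \<Longrightarrow> t \<in> {0..T} \<Longrightarrow> ((\<lambda>\<tau>. A m \<sigma> \<tau>) has_real_derivative E m \<sigma> t) (at t within {0..T})" and
    G: "\<And>\<sigma> t. t \<in> {0..T} \<Longrightarrow> ((\<lambda>\<tau>. E 0 \<sigma> \<tau>) has_real_derivative G \<sigma> t) (at t within {0..T})" and
    B: "0 \<le> B" and
    DB: "\<And>m \<sigma> t. m \<le> 6 \<Longrightarrow> \<sigma> \<in> {a..b} \<Longrightarrow> t \<in> {0..T} \<Longrightarrow> \<bar>D m \<sigma> t\<bar> \<le> B" and
    AB: "\<And>m \<sigma> t. m \<le> 4 \<Longrightarrow> \<sigma> \<in> {a..b} \<Longrightarrow> t \<in> {0..T} \<Longrightarrow> \<bar>A m \<sigma> t\<bar> \<le> B" and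
    EB: "\<And>m \<sigma> t. m \<le> 4 \<Longrightarrow> \<sigma> \<in> {a..b} \<Longrightarrow> t \<in> {0..T} \<Longrightarrow> \<bar>E m \<sigma> t\<bar> \<le> B" and
    GB: "\<And>\<sigma> t. \<sigma> \<in> {a..b} \<Longrightarrow> t \<in> {0..T} \<Longrightarrow> \<bar>G \<sigma> t\<bar> \<le> B"
  proof (rule smooth_strip_derivs[OF smooth, where a = a and b = b], goal_cases)
    case (1 D A E G B)
    from 1(2-) show ?case by (rule 1(1))
  qed
  obtain C where C: "0 \<le> C" "\<And>r. r0 \<le> r \<Longrightarrow> \<bar>\<delta> / r ^ 4\<bar> \<le> C"
    "\<And>r. r0 \<le> r \<Longrightarrow> \<bar>1 / r ^ 2 * (\<alpha> - 1 + \<delta> / r ^ 2)\<bar> \<le> C"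
    "\<And>r. r0 \<le> r \<Longrightarrow> \<bar>(\<alpha> - 1) / r ^ 2\<bar> \<le> C"
    "\<And>r. r0 \<le> r \<Longrightarrow> \<bar>v_c / r ^ 2\<bar> \<le> C"
    using coefficients_bounded[OF r0(1), of \<delta> \<alpha> v_c] by metis
  have avg: "\<bar>(D m \<sigma> (t + k / 2) + D m \<sigma> (t - k / 2)) / 2 - D m \<sigma> t\<bar> \<le> B * k\<^sup>2"
    if m: "m \<le> 4" and \<sigma>: "\<sigma> \<in> {a..b}" and k: "0 < k" "0 \<le> t - k / 2" "t + k / 2 \<le> T" for m \<sigma> t k
  proof (rule midpoint_taylor(1)[where S = "{0..T}"])
    fix y assume y: "y \<in> {0..T}"
    show "(D m \<sigma> has_real_derivative A m \<sigma> y) (at y within {0..T})" by (rule A[OF m y])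
    show "(A m \<sigma> has_real_derivative E m \<sigma> y) (at y within {0..T})" by (rule E[OF m y])
    show "\<bar>E m \<sigma> y\<bar> \<le> B" by (rule EB[OF m \<sigma> y])
  qed (use k in auto)
  \<comment> \<open>Midpoints of time steps lie strictly inside \<open>{0..T}\<close>. There the
    derivative within the interval is an ordinary, hence unique, derivative, which identifies the
    one given by \<open>solves_pde\<close> with \<open>A 0\<close>.\<close>
  have pde': "A 0 \<sigma> t + \<delta> / R t ^ 4 * D 4 \<sigma> t + 1 / R t ^ 2 * (\<alpha> - 1 + \<delta> / R t ^ 2) * D 2 \<sigma> t
      + (\<alpha> - 1) / R t ^ 2 * D 0 \<sigma> t - v_c / R t ^ 2 * (D 0 \<sigma> t * D 1 \<sigma> t) = 0"
    if t: "0 < t" "t < T" for \<sigma> t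
  proof -
    have t': "t \<in> {0..T}" using t by simp
    obtain vt where vt: "((\<lambda>\<tau>. v \<sigma> \<tau>) has_real_derivative vt) (at t within {0..T})"
      "vt + \<delta> / R t ^ 4 * (deriv ^^ 4) (\<lambda>s. v s t) \<sigma>
           + 1 / R t ^ 2 * (\<alpha> - 1 + \<delta> / R t ^ 2) * (deriv ^^ 2) (\<lambda>s. v s t) \<sigma>
           + (\<alpha> - 1) / R t ^ 2 * v \<sigma> t
           - v_c / R t ^ 2 * v \<sigma> t * deriv (\<lambda>s. v s t) \<sigma> = 0"
      using pde t' unfolding solves_pde_def by blast
    have "at t within {0..T} = at t" using t by (intro at_within_Icc_at)
    then have "vt = A 0 \<sigma> t"
      using vt(1) A[of 0 t \<sigma>] t' D0 DERIV_unique by fastforce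
    moreover have "(deriv ^^ m) (\<lambda>s. v s t) = (\<lambda>s. D m s t)" if "m \<le> 6" for m
      using deriv_funpow[of "\<lambda>m s. D m s t" "\<lambda>s. v s t" 6 m] D[OF _ t'] D0 that by simp
    from this[of 4] this[of 2] this[of 1]
    have "(deriv ^^ 4) (\<lambda>s. v s t) = (\<lambda>s. D 4 s t)" "(deriv ^^ 2) (\<lambda>s. v s t) = (\<lambda>s. D 2 s t)"
      "deriv (\<lambda>s. v s t) = (\<lambda>s. D 1 s t)" by simp_all
    ultimately show ?thesis using vt(2) D0 by (simp add: mult.assoc)
  qed
  \<comment> \<open>Since \<Phi> is arbitrary, one estimate of the linear part serves both
    discretizations of the nonlinearity, those of \<open>nonlin\<close> and
    \<open>nonlin0\<close>.\<close>
  have main: "\<bar>1 / k * (V1 i - V0 i) + 1 / 2 * lin_op \<delta> \<alpha> (R t) h (\<lambda>l. V1 l + V0 l) i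
      - v_c / (R t)\<^sup>2 * \<Phi>\<bar> \<le> (B + 4 * C * B) * (k\<^sup>2 + h\<^sup>2) + C * \<bar>\<Phi> - D 0 x t * D 1 x t\<bar>"
    and nonlin: "\<bar>phi (\<lambda>l. V1 l + V0 l) (\<lambda>l. V1 l + V0 l) i / (24 * h) - D 0 x t * D 1 x t\<bar>
        \<le> 2 * B\<^sup>2 * (k\<^sup>2 + h\<^sup>2)"
    and nonlin0: "\<bar>phi V0 V0 i / (6 * h) - D 0 x t * D 1 x t\<bar> \<le> 2 * B\<^sup>2 * (k + h\<^sup>2)"
    if hk: "0 < h" "h \<le> 2 * pi" "0 < k" "0 \<le> t - k / 2" "t + k / 2 \<le> T"
      and x: "x = of_int i * h" "x \<in> {0..2 * pi}"
      and V: "V0 = (\<lambda>l. v (of_int l * h) (t - k / 2))" "V1 = (\<lambda>l. v (of_int l * h) (t + k / 2))"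
    for h k t i x \<Phi> V0 V1
  proof -
    \<comment> \<open>The tower of time averages. As \<open>V1 + V0\<close> is twice
      \<open>f 0\<close> on the grid, the quadratic \<open>phi\<close> picks up a factor 4, which
      explains 24 against 6 in the two nonlinear quotients.\<close>
    define f where "f m s = (D m s (t + k / 2) + D m s (t - k / 2)) / 2" for m s
    have tt: "t + k / 2 \<in> {0..T}" "t - k / 2 \<in> {0..T}" "t \<in> {0..T}" "0 < t" "t < T"
      using hk by auto
    have xs: "x \<in> {a..b}" "x + h \<in> {a..b}" "x - h \<in> {a..b}" "x + 2 * h \<in> {a..b}" "x - 2 * h \<in> {a..b}"
      using x(2) hk(1,2) by (auto simp: a_def b_def)
    have fder: "(f m has_real_derivative f (Suc m) y) (at y within {a..b})" if "m < 6" for m y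
    proof -
      have "(f m has_real_derivative f (Suc m) y) (at y)"
        unfolding f_def using D[OF that tt(1)] D[OF that tt(2)]
        by (intro DERIV_cdivide DERIV_add)
      then show ?thesis by (rule has_field_derivative_at_within)
    qed
    have fB: "\<bar>f m y\<bar> \<le> B" if "m \<le> 6" "y \<in> {a..b}" for m y
      using DB[OF that tt(1)] DB[OF that tt(2)] unfolding f_def add_divide_distrib abs_le_iff by linarith
    note tay = lap_taylor(1,4)[of "{a..b}" f B h x, OF convex_closed_interval fder fB hk(1) xs(1-3)]
    define Q2 where "Q2 = (f 0 (x - h) - 2 * f 0 x + f 0 (x + h)) / h\<^sup>2"
    define Q4 where "Q4 = (f 0 (x - 2 * h) - 4 * f 0 (x - h) + 6 * f 0 x - 4 * f 0 (x + h)
      + f 0 (x + 2 * h)) / h ^ 4"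
    have fD: "\<bar>f m x - D m x t\<bar> \<le> B * k\<^sup>2" if "m \<le> 4" for m
      using avg[OF that xs(1) hk(3-5)] by (simp add: f_def)
    have q2: "\<bar>Q2 - D 2 x t\<bar> \<le> B * (k\<^sup>2 + h\<^sup>2)"
      using tay(1) fD[of 2] unfolding Q2_def[symmetric] by (simp add: algebra_simps)
    have q4: "\<bar>Q4 - D 4 x t\<bar> \<le> 2 * B * (k\<^sup>2 + h\<^sup>2)"
    proof -
      have "0 \<le> B * k\<^sup>2" using B by simp
      then show ?thesis using tay(2) xs fD[of 4] unfolding Q4_def[symmetric]
        by (simp add: algebra_simps)
    qed
    have q0: "\<bar>f 0 x - D 0 x t\<bar> \<le> B * (k\<^sup>2 + h\<^sup>2)"
    proof -
      have "0 \<le> B * h\<^sup>2" using B by simp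
      then show ?thesis using fD[of 0] by (simp add: algebra_simps)
    qed
    have qt: "\<bar>(V1 i - V0 i) / k - A 0 x t\<bar> \<le> B * (k\<^sup>2 + h\<^sup>2)"
    proof -
      have "\<bar>(D 0 x (t + k / 2) - D 0 x (t - k / 2)) / k - A 0 x t\<bar> \<le> B * k\<^sup>2"
      proof (rule midpoint_taylor(2)[where S = "{0..T}"])
        fix y assume y: "y \<in> {0..T}"
        show "(D 0 x has_real_derivative A 0 x y) (at y within {0..T})" by (rule A[OF _ y]) simp
        show "(A 0 x has_real_derivative E 0 x y) (at y within {0..T})" by (rule E[OF _ y]) simp
        show "(E 0 x has_real_derivative G x y) (at y within {0..T})" by (rule G[OF y])
        show "\<bar>E 0 x y\<bar> \<le> B" by (rule EB[OF _ xs(1) y]) simp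
        show "\<bar>G x y\<bar> \<le> B" by (rule GB[OF xs(1) y])
      qed (use tt hk in auto)
      moreover have "0 \<le> B * h\<^sup>2" using B by simp
      ultimately have "\<bar>(D 0 x (t + k / 2) - D 0 x (t - k / 2)) / k - A 0 x t\<bar> \<le> B * (k\<^sup>2 + h\<^sup>2)"
        unfolding distrib_left by linarith
      then show ?thesis by (simp only: V D0 x(1))
    qed
    have V2: "V1 l + V0 l = 2 * f 0 (of_int l * h)" for l by (simp add: f_def V D0)
    have idx: "of_int (i - 1) * h = x - h" "of_int (i + 1) * h = x + h"
        "of_int (i - 2) * h = x - 2 * h" "of_int (i + 2) * h = x + 2 * h" "of_int i * h = x"
      by (simp_all add: x(1) algebra_simps)
    have l2: "lap h (\<lambda>l. V1 l + V0 l) i = 2 * Q2"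
      unfolding lap_def V2 idx Q2_def by (simp add: algebra_simps)
    have l4: "lap h (lap h (\<lambda>l. V1 l + V0 l)) i = 2 * Q4"
      unfolding lap_lap V2 idx Q4_def by (simp add: algebra_simps)
    define c4 c2 c0 c where "c4 = \<delta> / R t ^ 4" and "c2 = 1 / R t ^ 2 * (\<alpha> - 1 + \<delta> / R t ^ 2)"
      and "c0 = (\<alpha> - 1) / R t ^ 2" and "c = v_c / R t ^ 2"
    have cs: "\<bar>c4\<bar> \<le> C" "\<bar>c2\<bar> \<le> C" "\<bar>c0\<bar> \<le> C" "\<bar>c\<bar> \<le> C"
      using C(2-5)[OF r0(2)[OF tt(3)]] unfolding c4_def c2_def c0_def c_def .
    have "1 / k * (V1 i - V0 i) + 1 / 2 * lin_op \<delta> \<alpha> (R t) h (\<lambda>l. V1 l + V0 l) i - v_c / (R t)\<^sup>2 * \<Phi>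
      = (V1 i - V0 i) / k + c4 * Q4 + c2 * Q2 + c0 * f 0 x - c * \<Phi>"
      unfolding lin_op_def l2 l4
      unfolding V2 idx c4_def[symmetric] c2_def[symmetric] c0_def[symmetric]
        c_def[symmetric] by (simp add: algebra_simps diff_divide_distrib)
    \<comment> \<open>The differential equation at \<open>(x, t)\<close> is subtracted; what remains
      are bounded coefficients times consistency errors.\<close>
    also have "\<dots> = ((V1 i - V0 i) / k - A 0 x t) + c4 * (Q4 - D 4 x t) + c2 * (Q2 - D 2 x t)
        + c0 * (f 0 x - D 0 x t) + - c * (\<Phi> - D 0 x t * D 1 x t)"
      using pde'[OF tt(4,5), of x] unfolding c4_def[symmetric] c2_def[symmetric] c0_def[symmetric]
        c_def[symmetric] by (simp add: algebra_simps)
    also have "\<bar>\<dots>\<bar> \<le> \<bar>(V1 i - V0 i) / k - A 0 x t\<bar> + \<bar>c4 * (Q4 - D 4 x t)\<bar> + \<bar>c2 * (Q2 - D 2 x t)\<bar>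
        + \<bar>c0 * (f 0 x - D 0 x t)\<bar> + \<bar>- c * (\<Phi> - D 0 x t * D 1 x t)\<bar>"
      by linarith
    also have "\<dots> \<le> B * (k\<^sup>2 + h\<^sup>2) + C * (2 * B * (k\<^sup>2 + h\<^sup>2)) + C * (B * (k\<^sup>2 + h\<^sup>2))
        + C * (B * (k\<^sup>2 + h\<^sup>2)) + C * \<bar>\<Phi> - D 0 x t * D 1 x t\<bar>"
      unfolding abs_mult abs_minus_cancel
      by (intro add_mono mult_mono qt q4 q2 q0 cs order_refl abs_ge_zero C(1))
    finally show "\<bar>1 / k * (V1 i - V0 i) + 1 / 2 * lin_op \<delta> \<alpha> (R t) h (\<lambda>l. V1 l + V0 l) i
      - v_c / (R t)\<^sup>2 * \<Phi>\<bar> \<le> (B + 4 * C * B) * (k\<^sup>2 + h\<^sup>2) + C * \<bar>\<Phi> - D 0 x t * D 1 x t\<bar>"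
      by (simp add: algebra_simps)
    have tri: "\<bar>l - c\<bar> \<le> \<epsilon> + \<epsilon>'" if "l = r" "\<bar>r - b\<bar> \<le> \<epsilon>" "\<bar>b - c\<bar> \<le> \<epsilon>'"
      for l r b c \<epsilon> \<epsilon>' :: real
      using that by linarith
    have prod: "\<bar>p * q - D 0 x t * D 1 x t\<bar> \<le> 2 * B * e"
      if "\<bar>p - D 0 x t\<bar> \<le> e" "\<bar>q - D 1 x t\<bar> \<le> e" "\<bar>p\<bar> \<le> B" for p q e
    proof -
      have "p * q - D 0 x t * D 1 x t = p * (q - D 1 x t) + (p - D 0 x t) * D 1 x t"
        by (simp add: algebra_simps)
      also have "\<bar>\<dots>\<bar> \<le> \<bar>p\<bar> * \<bar>q - D 1 x t\<bar> + \<bar>p - D 0 x t\<bar> * \<bar>D 1 x t\<bar>"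
        by (metis abs_mult abs_triangle_ineq)
      also have "\<dots> \<le> B * e + e * B"
        using that DB[of 1 x t] xs tt B by (intro add_mono mult_mono) auto
      finally show ?thesis by simp
    qed
    have "phi (\<lambda>l. V1 l + V0 l) (\<lambda>l. V1 l + V0 l) i / (24 * h)
        = (f 0 (x - h) + f 0 x + f 0 (x + h)) * (f 0 (x + h) - f 0 (x - h)) / (6 * h)" (is "?l = ?r")
      unfolding phi_def V2 idx using hk(1) by (simp add: field_simps)
    moreover have "\<bar>?r - f 0 x * f 1 x\<bar> \<le> 2 * B\<^sup>2 * h\<^sup>2"
      by (rule phi_taylor[of "{a..b}" f B h x, OF convex_closed_interval fder fB hk(1) xs(1-3)])
    moreover have "\<bar>f 0 x * f 1 x - D 0 x t * D 1 x t\<bar> \<le> 2 * B * (B * k\<^sup>2)"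
      using fD[of 0] fD[of 1] fB[of 0 x] xs by (intro prod) auto
    ultimately have "\<bar>?l - D 0 x t * D 1 x t\<bar> \<le> 2 * B\<^sup>2 * h\<^sup>2 + 2 * B * (B * k\<^sup>2)"
      by (rule tri)
    then show "\<bar>?l - D 0 x t * D 1 x t\<bar> \<le> 2 * B\<^sup>2 * (k\<^sup>2 + h\<^sup>2)"
      by (simp add: power2_eq_square algebra_simps)
    have "phi V0 V0 i / (6 * h) = (D 0 (x - h) (t - k / 2) + D 0 x (t - k / 2) + D 0 (x + h) (t - k / 2))
        * (D 0 (x + h) (t - k / 2) - D 0 (x - h) (t - k / 2)) / (6 * h)" (is "?l = ?r")
      unfolding phi_def V idx D0 by simp
    moreover have "\<bar>?r - D 0 x (t - k / 2) * D 1 x (t - k / 2)\<bar> \<le> 2 * B\<^sup>2 * h\<^sup>2"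
      by (rule phi_taylor[of "{a..b}" "\<lambda>m s. D m s (t - k / 2)" B h x, OF convex_closed_interval
            has_field_derivative_at_within[OF D[OF _ tt(2)]] DB[OF _ _ tt(2)] hk(1) xs(1-3)])
    moreover have "\<bar>D 0 x (t - k / 2) * D 1 x (t - k / 2) - D 0 x t * D 1 x t\<bar> \<le> 2 * B * (B * k)"
    proof (rule prod)
      have "\<bar>D m x (t - k / 2) - D m x t\<bar> \<le> B * k" if "m \<le> 4" for m
      proof -
        have "norm (D m x (t - k / 2) - D m x t) \<le> B * norm (t - k / 2 - t)"
          by (rule field_differentiable_bound[of "{0..T}" _ "A m x"])
            (use A[OF that] AB[OF that xs(1)] tt in auto)
        also have "\<dots> \<le> B * k" using hk B by (intro mult_left_mono) auto
        finally show ?thesis by simp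
      qed
      then show "\<bar>D 0 x (t - k / 2) - D 0 x t\<bar> \<le> B * k" "\<bar>D 1 x (t - k / 2) - D 1 x t\<bar> \<le> B * k"
        by auto
      show "\<bar>D 0 x (t - k / 2)\<bar> \<le> B" using DB[of 0] xs tt by simp
    qed
    ultimately have "\<bar>?l - D 0 x t * D 1 x t\<bar> \<le> 2 * B\<^sup>2 * h\<^sup>2 + 2 * B * (B * k)"
      by (rule tri)
    then show "\<bar>?l - D 0 x t * D 1 x t\<bar> \<le> 2 * B\<^sup>2 * (k + h\<^sup>2)"
      by (simp add: power2_eq_square algebra_simps)
  qed
  \<comment> \<open>The summand \<open>8 * B\<close> comes from the second time difference, which is
    twice the averaging error over a step of length \<open>2 * k\<close>; it also covers the single
    \<open>B\<close> of \<open>main\<close>. The last summand is the nonlinear error multiplied by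
    its coefficient bound.\<close>
  define B' where "B' = 8 * B + 4 * C * B + C * (2 * B\<^sup>2)"
  have B': "8 * B \<le> B'" using B C(1) by (simp add: B'_def)
  show thesis
  proof (rule that[of B'])
    show "0 \<le> B'" using B B' by linarith
    show "\<bar>v \<sigma> t\<bar> \<le> B'" if "\<sigma> \<in> {0..2 * pi}" "t \<in> {0..T}" for \<sigma> t
      using DB[of 0 \<sigma> t] that sub B B' D0 by fastforce
    show "\<bar>v \<sigma> (t + k) - 2 * v \<sigma> t + v \<sigma> (t - k)\<bar> \<le> B' * k\<^sup>2"
      if "\<sigma> \<in> {0..2 * pi}" "0 < k" "0 \<le> t - k" "t + k \<le> T" for \<sigma> t k
    proof -
      have "\<bar>(v \<sigma> (t + k) + v \<sigma> (t - k)) / 2 - v \<sigma> t\<bar> \<le> 4 * (B * k\<^sup>2)"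
        using avg[of 0 \<sigma> "2 * k" t] that sub D0 by (auto simp: power_mult_distrib)
      then have "\<bar>v \<sigma> (t + k) - 2 * v \<sigma> t + v \<sigma> (t - k)\<bar> \<le> 8 * B * k\<^sup>2"
        unfolding abs_le_iff by (simp add: field_simps)
      also have "\<dots> \<le> B' * k\<^sup>2" using B' by (intro mult_right_mono) auto
      finally show ?thesis .
    qed
  next
    fix h k t :: real and i V0 V1
    assume h: "0 < h" "h \<le> 2 * pi" and k: "0 < k"
      and t: "0 \<le> t - k / 2" "t + k / 2 \<le> T" and x: "of_int i * h \<in> {0..2 * pi}"
      and V: "V0 = (\<lambda>l. v (of_int l * h) (t - k / 2))" "V1 = (\<lambda>l. v (of_int l * h) (t + k / 2))"
    have reg: "v_c / (24 * h * (R t)\<^sup>2) * y = v_c / (R t)\<^sup>2 * (y / (24 * h))"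
      "v_c / (6 * h * (R t)\<^sup>2) * y = v_c / (R t)\<^sup>2 * (y / (6 * h))" for y
      by simp_all
    note m = main[OF h k t refl x V] and n = nonlin[OF h k t refl x V] and n0 = nonlin0[OF h k t refl x V]
    show "\<bar>1 / k * (V1 i - V0 i) + 1 / 2 * lin_op \<delta> \<alpha> (R t) h (\<lambda>l. V1 l + V0 l) i
          - v_c / (24 * h * (R t)\<^sup>2) * phi (\<lambda>l. V1 l + V0 l) (\<lambda>l. V1 l + V0 l) i\<bar> \<le> B' * (k\<^sup>2 + h\<^sup>2)"
    proof -
      have "0 \<le> B * k\<^sup>2" "0 \<le> B * h\<^sup>2" using B by auto
      then show ?thesis
        unfolding reg using m mult_left_mono[OF n C(1)]
        by (rule_tac order_trans[OF m]) (simp add: B'_def algebra_simps)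
    qed
    assume k1: "k \<le> 1"
    show "\<bar>1 / k * (V1 i - V0 i) + 1 / 2 * lin_op \<delta> \<alpha> (R t) h (\<lambda>l. V1 l + V0 l) i
          - v_c / (6 * h * (R t)\<^sup>2) * phi V0 V0 i\<bar> \<le> B' * (k + h\<^sup>2)"
    proof -
      have "k\<^sup>2 \<le> k" using k k1 by (simp add: power2_eq_square)
      then have "(B + 4 * C * B) * (k\<^sup>2 + h\<^sup>2) \<le> (B + 4 * C * B) * (k + h\<^sup>2)"
        using B C(1) by (intro mult_left_mono) auto
      moreover have "0 \<le> B * k" "0 \<le> B * h\<^sup>2" using B k by auto
      ultimately show ?thesis
        unfolding reg using mult_left_mono[OF n0 C(1)]
        by (rule_tac order_trans[OF m]) (simp add: B'_def algebra_simps)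
    qed
  qed
qed

section \<open>Stability\<close>

lemma lin_op_diff:
  "lin_op \<delta> \<alpha> r h (\<lambda>l. V l - W l) i = lin_op \<delta> \<alpha> r h V i - lin_op \<delta> \<alpha> r h W i"
proof -
  have lap: "lap h (\<lambda>l. V l - W l) = (\<lambda>i. lap h V i - lap h W i)" for V W
    unfolding lap_def by (rule ext) (simp add: diff_divide_distrib[symmetric] algebra_simps)
  show ?thesis unfolding lin_op_def lap by (simp add: right_diff_distrib)
qed

text \<open>Expanding the quadratic nonlinearity about \<open>U\<close>: the linear part of the Newton step
  cancels except for the error of the previous iterate, and the Newton remainder is quadratic
  in the extrapolation error.\<close>
lemma newton_error_equation:
  assumes exact: "1 / k * (v' i - vn i) + 1 / 2 * lin_op \<delta> \<alpha> r h (\<lambda>l. v' l + vn l) i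
      - c * phi (\<lambda>l. v' l + vn l) (\<lambda>l. v' l + vn l) i = \<tau>"
    and newton: "1 / k * (W' i - Vn i) + 1 / 2 * lin_op \<delta> \<alpha> r h (\<lambda>l. W' l + Vn l) i
      = c * (psi U (\<lambda>l. W l - Vh l) i + phi U U i)"
    and U: "U = (\<lambda>l. Vn l + Vh l)"
    and \<theta>: "\<theta> = (\<lambda>l. v' l + vn l - U l)"
  shows "1 / k * ((v' i - W' i) - (vn i - Vn i))
      + 1 / 2 * lin_op \<delta> \<alpha> r h (\<lambda>l. (v' l - W' l) + (vn l - Vn l)) i
    = c * (psi U (\<lambda>l. (v' l - W l) + (vn l - Vn l)) i + psi \<theta> \<theta> i / 2) + \<tau>"
proof -
  have L: "lin_op \<delta> \<alpha> r h (\<lambda>l. (v' l - W' l) + (vn l - Vn l)) i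
      = lin_op \<delta> \<alpha> r h (\<lambda>l. v' l + vn l) i - lin_op \<delta> \<alpha> r h (\<lambda>l. W' l + Vn l) i"
    unfolding lin_op_diff[symmetric] by (simp add: algebra_simps)
  have N: "phi (\<lambda>l. v' l + vn l) (\<lambda>l. v' l + vn l) i - (psi U (\<lambda>l. W l - Vh l) i + phi U U i)
      = psi U (\<lambda>l. (v' l - W l) + (vn l - Vn l)) i + psi \<theta> \<theta> i / 2"
    unfolding \<theta> U phi_def psi_def by (simp add: field_simps)
  have "1 / k * ((v' i - W' i) - (vn i - Vn i))
      + 1 / 2 * lin_op \<delta> \<alpha> r h (\<lambda>l. (v' l - W' l) + (vn l - Vn l)) i
    = (1 / k * (v' i - vn i) + 1 / 2 * lin_op \<delta> \<alpha> r h (\<lambda>l. v' l + vn l) i)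
      - (1 / k * (W' i - Vn i) + 1 / 2 * lin_op \<delta> \<alpha> r h (\<lambda>l. W' l + Vn l) i)"
    unfolding L by (simp add: algebra_simps)
  also have "\<dots> = c * (phi (\<lambda>l. v' l + vn l) (\<lambda>l. v' l + vn l) i
      - (psi U (\<lambda>l. W l - Vh l) i + phi U U i)) + \<tau>"
    unfolding newton exact[symmetric] by (simp add: algebra_simps)
  finally show ?thesis unfolding N .
qed

section \<open>Energy estimates for one linear solve\<close>

lemma gip_add_left: "gip J (\<lambda>i. V i + W i) X = gip J V X + gip J W X"
  by (simp add: gip_def distrib_right sum.distrib)

lemma gip_scale_left: "gip J (\<lambda>i. a * V i) X = a * gip J V X"
  by (simp add: gip_def sum_distrib_left mult.assoc)

text \<open>Coercivity with \<open>\<mu> = c\<close> pays for the difference quotient in the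
  nonlinearity: the two terms with \<open>psi\<close> cost \<open>c / 2\<close> and
  \<open>c / 4\<close> times the squared first differences of \<open>E' + e\<close>. The constant
  \<open>K\<close> depends on \<open>A\<close> but not on the grid, and \<open>A\<close> bounds only
  \<open>U\<close> and \<theta>, not the errors \<open>E\<close> and \<open>E'\<close> of the
  iterates. The term \<open>sq J e\<close> outside the product with \<open>k\<close> has coefficient
  exactly 1, as a Gronwall argument requires.\<close>

lemma newton_step_estimate:
  assumes "0 < d" "0 \<le> b" "0 \<le> c"
  obtains K where "0 \<le> K" "\<And>\<delta> \<alpha> r h k J U \<theta> E E' e \<tau> c'.
    \<lbrakk>U \<in> periodic_grid J; \<theta> \<in> periodic_grid J; E \<in> periodic_grid J; E' \<in> periodic_grid J;
     e \<in> periodic_grid J; d \<le> \<delta> / r ^ 4; 1 / r ^ 2 * (\<alpha> - 1 + \<delta> / r ^ 2) \<le> b;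
     - b \<le> (\<alpha> - 1) / r ^ 2; 0 < k; 0 < h; \<bar>c'\<bar> \<le> c; \<And>i. \<bar>U i\<bar> \<le> A; \<And>i. \<bar>\<theta> i\<bar> \<le> A;
     \<And>i. i \<in> {1..int J} \<Longrightarrow> 1 / k * (E' i - e i) + 1 / 2 * lin_op \<delta> \<alpha> r h (\<lambda>l. E' l + e l) i
       = c' / h * (psi U (\<lambda>l. E l + e l) i + psi \<theta> \<theta> i / 2) + \<tau> i\<rbrakk>
    \<Longrightarrow> sq J E' \<le> sq J e + k * K * (sq J E + sq J E' + sq J e + sq J \<theta> + sq J \<tau>)"
proof -
  obtain C where C: "0 \<le> C" "\<And>\<delta> \<alpha> r h J X. \<lbrakk>X \<in> periodic_grid J; d \<le> \<delta> / r ^ 4;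
      1 / r ^ 2 * (\<alpha> - 1 + \<delta> / r ^ 2) \<le> b; - b \<le> (\<alpha> - 1) / r ^ 2\<rbrakk>
    \<Longrightarrow> c * sq J (fdiff h X) - C * sq J X \<le> 1 / 2 * gip J (lin_op \<delta> \<alpha> r h X) X"
    using lin_op_coercive[OF assms(1,2,2,3)] by blast
  \<comment> \<open>The factors 36 and \<open>2 * C\<close> double 18 and \<open>C\<close>, because
    the squares of the sums \<open>E + e\<close> and \<open>E' + e\<close> are split; the
    \<open>+ 1\<close> covers \<tau> and the quarter of \<open>sq J X\<close> left by Young's
    inequality.\<close>
  define K where "K = 36 * A\<^sup>2 * c + 2 * C + 1"
  show thesis
  proof (rule that[of K])
    show "0 \<le> K" using C(1) assms by (simp add: K_def)
    fix \<delta> \<alpha> r h k c' :: real and J U \<theta> E E' e \<tau>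
    assume per: "U \<in> periodic_grid J" "\<theta> \<in> periodic_grid J" "E \<in> periodic_grid J"
        "E' \<in> periodic_grid J" "e \<in> periodic_grid J"
      and r: "d \<le> \<delta> / r ^ 4" "1 / r ^ 2 * (\<alpha> - 1 + \<delta> / r ^ 2) \<le> b" "- b \<le> (\<alpha> - 1) / r ^ 2"
      and k: "0 < k" and h: "0 < h" and c': "\<bar>c'\<bar> \<le> c"
      and A: "\<And>i. \<bar>U i\<bar> \<le> A" "\<And>i. \<bar>\<theta> i\<bar> \<le> A"
      and eq: "\<And>i. i \<in> {1..int J} \<Longrightarrow> 1 / k * (E' i - e i) + 1 / 2 * lin_op \<delta> \<alpha> r h (\<lambda>l. E' l + e l) i
       = c' / h * (psi U (\<lambda>l. E l + e l) i + psi \<theta> \<theta> i / 2) + \<tau> i"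
    define X where "X = (\<lambda>l. E' l + e l)"
    define Y where "Y = (\<lambda>l. E l + e l)"
    define F where "F = (\<lambda>i. c' / h * (psi U Y i + (1 / 2) * psi \<theta> \<theta> i) + \<tau> i)"
    define P where "P = sq J (fdiff h X)"
    have X: "X \<in> periodic_grid J" and Y: "Y \<in> periodic_grid J"
      unfolding X_def Y_def
      using periodic_grid_pointwise[OF per(4,5), of "(+)"] periodic_grid_pointwise[OF per(3,5), of "(+)"]
      by simp_all
    have sqX: "sq J X \<le> 2 * sq J E' + 2 * sq J e" and sqY: "sq J Y \<le> 2 * sq J E + 2 * sq J e"
      using sq_lincomb2[of J 1 E' 1 e] sq_lincomb2[of J 1 E 1 e] by (simp_all add: X_def Y_def)
    have P: "0 \<le> P" by (simp add: P_def)
    have "gip J F X = c' * (gip J (psi U Y) X / h) + (c' / 2) * (gip J (psi \<theta> \<theta>) X / h) + gip J \<tau> X"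
      unfolding F_def gip_add_left gip_scale_left by (simp add: algebra_simps)
    also have "\<dots> \<le> c * (18 * A\<^sup>2 * sq J Y + P / 2) + (c / 2) * (18 * A\<^sup>2 * sq J \<theta> + P / 2)
        + (sq J \<tau> + sq J X / 4)"
    proof (intro add_mono)
      have "c' * (gip J (psi U Y) X / h) \<le> \<bar>c'\<bar> * (\<bar>gip J (psi U Y) X\<bar> / h)"
        using h by (metis abs_divide abs_ge_self abs_mult abs_of_pos)
      also have "\<dots> \<le> c * (18 * A\<^sup>2 * sq J Y + P / 2)"
        unfolding P_def using gip_psi_bound[OF per(1) Y X A(1) h] c' h by (intro mult_mono) auto
      finally show "c' * (gip J (psi U Y) X / h) \<le> \<dots>" .
      have "c' / 2 * (gip J (psi \<theta> \<theta>) X / h) \<le> \<bar>c' / 2\<bar> * (\<bar>gip J (psi \<theta> \<theta>) X\<bar> / h)"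
        using h by (metis abs_divide abs_ge_self abs_mult abs_of_pos)
      also have "\<dots> \<le> (c / 2) * (18 * A\<^sup>2 * sq J \<theta> + P / 2)"
        unfolding P_def using gip_psi_bound[OF per(2) per(2) X A(2) h] c' h by (intro mult_mono) auto
      finally show "c' / 2 * (gip J (psi \<theta> \<theta>) X / h) \<le> \<dots>" .
      show "gip J \<tau> X \<le> sq J \<tau> + sq J X / 4" using gip_young[of 1 J \<tau> X] by simp
    qed
    finally have F: "gip J F X \<le> \<dots>" .
    have cP: "0 \<le> c * P" using assms P by simp
    have "gip J F X - 1 / 2 * gip J (lin_op \<delta> \<alpha> r h X) X
        \<le> 18 * A\<^sup>2 * c * sq J Y + 9 * A\<^sup>2 * c * sq J \<theta> + sq J \<tau> + (C + 1 / 4) * sq J X"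
      using F C(2)[OF X r, of h] cP unfolding P_def[symmetric] by (simp add: algebra_simps)
    also have "\<dots> \<le> 18 * A\<^sup>2 * c * (2 * sq J E + 2 * sq J e) + 9 * A\<^sup>2 * c * sq J \<theta> + sq J \<tau>
        + (C + 1 / 4) * (2 * sq J E' + 2 * sq J e)"
      using sqX sqY C(1) assms by (intro add_mono mult_left_mono) auto
    also have "\<dots> \<le> K * (sq J E + sq J E' + sq J e + sq J \<theta> + sq J \<tau>)"
    proof -
      have aux: "18 * a * (2 * x + 2 * z) + 9 * a * t + s + (C + 1 / 4) * (2 * y + 2 * z)
          \<le> (36 * a + 2 * C + 1) * (x + y + z + t + s)"
        if nn: "0 \<le> a" "0 \<le> x" "0 \<le> y" "0 \<le> z" "0 \<le> t" "0 \<le> s" for a x y z t s :: real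
      proof -
        have "0 \<le> 36 * a * (y + s) + 27 * a * t + 2 * C * (x + t + s) + (x + y / 2 + z / 2 + t)"
          using nn C(1) by (intro add_nonneg_nonneg mult_nonneg_nonneg) auto
        also have "\<dots> = (36 * a + 2 * C + 1) * (x + y + z + t + s)
            - (18 * a * (2 * x + 2 * z) + 9 * a * t + s + (C + 1 / 4) * (2 * y + 2 * z))"
          by (simp add: field_simps)
        finally show ?thesis by simp
      qed
      show ?thesis
        unfolding K_def using aux[of "A\<^sup>2 * c" "sq J E" "sq J E'" "sq J e" "sq J \<theta>" "sq J \<tau>"] assms
        by (simp add: mult.assoc)
    qed
    finally have "k * (gip J F X - 1 / 2 * gip J (lin_op \<delta> \<alpha> r h X) X)
        \<le> k * (K * (sq J E + sq J E' + sq J e + sq J \<theta> + sq J \<tau>))"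
      using k by (intro mult_left_mono) auto
    moreover have "sq J E' - sq J e = k * (gip J F X - 1 / 2 * gip J (lin_op \<delta> \<alpha> r h X) X)"
      unfolding X_def
      by (rule energy_identity[OF k]) (drule eq, simp add: F_def Y_def)
    ultimately show "sq J E' \<le> sq J e + k * K * (sq J E + sq J E' + sq J e + sq J \<theta> + sq J \<tau>)"
      by (simp add: mult.assoc)
  qed
qed

text \<open>With zero initial error, Young's inequality can be used with weight \<open>k\<close>:
  its part \<open>sq J E / (4 * k)\<close>, multiplied by \<open>k\<close>, is absorbed on the left,
  and the truncation error gains the factor \<open>k\<^sup>2\<close>. This makes up for the lower
  consistency order of the first step.\<close>

lemma first_step_estimate:
  assumes "0 < d" "0 \<le> b"
  obtains K where "0 < K" "\<And>\<delta> \<alpha> r h k J E \<tau>.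
    \<lbrakk>E \<in> periodic_grid J; d \<le> \<delta> / r ^ 4; 1 / r ^ 2 * (\<alpha> - 1 + \<delta> / r ^ 2) \<le> b;
     - b \<le> (\<alpha> - 1) / r ^ 2; 0 < k; k * K \<le> 1;
     \<And>i. i \<in> {1..int J} \<Longrightarrow> 1 / k * E i + 1 / 2 * lin_op \<delta> \<alpha> r h E i = \<tau> i\<rbrakk>
    \<Longrightarrow> sq J E \<le> 2 * k\<^sup>2 * sq J \<tau>"
proof -
  obtain C where C: "0 \<le> C" "\<And>\<delta> \<alpha> r h J X. \<lbrakk>X \<in> periodic_grid J; d \<le> \<delta> / r ^ 4;
      1 / r ^ 2 * (\<alpha> - 1 + \<delta> / r ^ 2) \<le> b; - b \<le> (\<alpha> - 1) / r ^ 2\<rbrakk>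
    \<Longrightarrow> 0 * sq J (fdiff h X) - C * sq J X \<le> 1 / 2 * gip J (lin_op \<delta> \<alpha> r h X) X"
    using lin_op_coercive[OF assms(1,2,2) order_refl] by blast
  show thesis
  \<comment> \<open>This constant forces \<open>k * C \<le> 1 / 4\<close>. Together with the quarter
    from Young's inequality, half of \<open>sq J E\<close> is absorbed, whence the factor 2 in the
    estimate.\<close>
  proof (rule that[of "4 * C + 1"])
    show "0 < 4 * C + 1" using C(1) by simp
    fix \<delta> \<alpha> r h k :: real and J E \<tau>
    assume E: "E \<in> periodic_grid J"
      and r: "d \<le> \<delta> / r ^ 4" "1 / r ^ 2 * (\<alpha> - 1 + \<delta> / r ^ 2) \<le> b" "- b \<le> (\<alpha> - 1) / r ^ 2"
      and k: "0 < k" "k * (4 * C + 1) \<le> 1"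
      and eq: "\<And>i. i \<in> {1..int J} \<Longrightarrow> 1 / k * E i + 1 / 2 * lin_op \<delta> \<alpha> r h E i = \<tau> i"
    have "sq J E = k * (gip J \<tau> E - 1 / 2 * gip J (lin_op \<delta> \<alpha> r h E) E)"
      using energy_identity[OF k(1), of J E "\<lambda>_. 0" \<delta> \<alpha> r h \<tau>] eq by (simp add: gip_def)
    also have "\<dots> \<le> k * ((k * sq J \<tau> + sq J E / (4 * k)) + C * sq J E)"
      using k(1) gip_young[OF k(1), of J \<tau> E] C(2)[OF E r, of h] by (intro mult_left_mono) auto
    also have "\<dots> = k\<^sup>2 * sq J \<tau> + sq J E / 4 + k * C * sq J E"
      using k(1) by (simp add: field_simps power2_eq_square)
    also have "k * C * sq J E \<le> 1 / 4 * sq J E"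
      using k by (intro mult_right_mono) (auto simp: algebra_simps)
    finally show "sq J E \<le> 2 * k\<^sup>2 * sq J \<tau>" by simp
  qed
qed

text \<open>The crude bound \<open>C * S\<close> reproduces itself under each step because
  \<open>k * C\<close> is small, so the number of steps is immaterial. One last step multiplies the
  crude bound by \<open>k * C\<close>, leaving \<open>a\<close> with coefficient 1 plus a term of
  order \<open>k\<close>. This is where \<open>1 \<le> m\<close> enters, since the starting value
  obeys the crude bound only.\<close>

lemma iteration_bound:
  fixes x :: "nat \<Rightarrow> real"
  assumes C: "4 \<le> C" "0 \<le> k" "k * C \<le> 1 / 8" and a: "0 \<le> a" "a \<le> S"
    and x: "x 0 \<le> C * S" "\<And>j. j < m \<Longrightarrow> x (Suc j) \<le> a + k * C * (x j + x (Suc j) + S)"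
    and xnn: "\<And>j. 0 \<le> x j" and m: "1 \<le> m"
  shows "x m \<le> a + k * (3 * C\<^sup>2) * S"
proof -
  have kC: "0 \<le> k * C" "0 \<le> S" using C a by auto
  have CS: "4 * S \<le> C * S" using C kC by (intro mult_right_mono) auto
  have bd: "x j \<le> C * S" if "j \<le> m" for j
    using that
  proof (induction j)
    case (Suc j)
    have "x (Suc j) \<le> a + k * C * (x j + x (Suc j) + S)" using x(2)[of j] Suc by simp
    also have "\<dots> \<le> S + 1 / 8 * (C * S + x (Suc j) + S)"
      using a C(3) kC xnn[of j] xnn[of "Suc j"] Suc by (intro add_mono mult_mono) auto
    finally have "7 * x (Suc j) \<le> 9 * S + C * S" by (simp add: field_simps)
    then show ?case using CS kC(2) by linarith
  qed (use x(1) in simp)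
  obtain j where j: "m = Suc j" using m by (cases m) auto
  have "x m \<le> a + k * C * (x j + x m + S)" using x(2)[of j] j by simp
  also have "\<dots> \<le> a + k * C * (C * S + C * S + C * S)"
    using bd[of j] bd[of m] j CS kC by (intro add_left_mono mult_left_mono add_mono) auto
  also have "\<dots> = a + k * (3 * C\<^sup>2) * S" by (simp add: power2_eq_square algebra_simps)
  finally show ?thesis .
qed

text \<open>The recursion is available only while the earlier values obey the very bound to be
  proved, which is how the maximum norm bound is carried along. Adding \<rho> to \<open>a\<close>
  absorbs the source term, and each step then costs at most the factor
  \<open>q = 1 + 2 * \<kappa>\<close>, the 2 stemming from the two levels on the right.\<close>

lemma discrete_gronwall:
  fixes a :: "nat \<Rightarrow> real"
  assumes \<kappa>: "0 \<le> \<kappa>" and G: "a 0 + \<rho> \<le> G" "a 1 + \<rho> \<le> G" "0 \<le> G" and \<rho>: "0 \<le> \<rho>"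
    and step: "\<And>n. \<lbrakk>1 \<le> n; n < N; \<And>m. m \<le> n \<Longrightarrow> a m \<le> exp (2 * \<kappa> * real N) * G\<rbrakk>
      \<Longrightarrow> a (Suc n) \<le> a n + \<kappa> * (a n + a (n - 1) + \<rho>)"
    and m: "m \<le> N"
  shows "a m \<le> exp (2 * \<kappa> * real N) * G"
proof -
  define q where "q = 1 + 2 * \<kappa>"
  have q: "1 \<le> q" using \<kappa> by (simp add: q_def)
  have qexp: "q ^ n * G \<le> exp (2 * \<kappa> * real N) * G" if "n \<le> N" for n
  proof -
    have "q ^ n \<le> exp (2 * \<kappa>) ^ n"
      using exp_ge_add_one_self[of "2 * \<kappa>"] q by (intro power_mono) (auto simp: q_def)
    also have "\<dots> = exp (2 * \<kappa> * real n)" by (simp add: exp_of_nat_mult[symmetric] mult.commute)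
    also have "\<dots> \<le> exp (2 * \<kappa> * real N)" using \<kappa> that by (simp add: mult_left_mono)
    finally show ?thesis using G(3) by (intro mult_right_mono) auto
  qed
  \<comment> \<open>All indices up to \<open>n\<close> are kept because the recursion reaches back
    two levels; the induction starts at 1 because two starting values are given.\<close>
  have "\<forall>l\<le>n. a l + \<rho> \<le> q ^ n * G" if "n \<le> N" "1 \<le> n" for n
    using that(2,1)
  proof (induction n rule: dec_induct)
    case base
    have "1 * G \<le> q * G" using q G(3) by (intro mult_right_mono) auto
    then show ?case using G by (auto simp: le_Suc_eq)
  next
    case (step n)
    then have IH: "\<And>l. l \<le> n \<Longrightarrow> a l + \<rho> \<le> q ^ n * G" by simp
    have "a (Suc n) \<le> a n + \<kappa> * (a n + a (n - 1) + \<rho>)"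
    proof (rule assms(6))
      show "a l \<le> exp (2 * \<kappa> * real N) * G" if "l \<le> n" for l
        using IH[OF that] qexp[of n] step.prems \<rho> by linarith
      show "1 \<le> n" "n < N" using step.hyps step.prems by simp_all
    qed
    also have "\<dots> \<le> (q ^ n * G - \<rho>) + \<kappa> * (q ^ n * G + q ^ n * G)"
    proof (rule add_mono[OF _ mult_left_mono[OF _ \<kappa>]])
      show "a n \<le> q ^ n * G - \<rho>" using IH[of n] by simp
      have "a (n - 1) + \<rho> \<le> q ^ n * G" by (rule IH) simp
      with IH[of n] \<rho> show "a n + a (n - 1) + \<rho> \<le> q ^ n * G + q ^ n * G" by linarith
    qed
    finally have new: "a (Suc n) + \<rho> \<le> q ^ Suc n * G" by (simp add: q_def algebra_simps)
    have "1 * (q ^ n * G) \<le> q * (q ^ n * G)" using q G(3) by (intro mult_right_mono) auto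
    then show ?case using IH new by (force simp: le_Suc_eq mult.assoc)
  qed
  note * = this
  show ?thesis
  proof (cases "m = 0")
    case True
    have "1 * G \<le> exp (2 * \<kappa> * real N) * G" using \<kappa> G(3) by (intro mult_right_mono) auto
    then show ?thesis unfolding True using G \<rho> by linarith
  next
    case False
    then show ?thesis using *[of m] qexp[of m] m \<rho> by fastforce
  qed
qed

text \<open>Both \<open>k\<^sup>2\<close> and \<open>h\<^sup>2\<close> are at most
  \<open>h powr (1 / 2)\<close> times a quantity tending to zero, namely
  \<open>(\<omega> h)\<^sup>2\<close> and \<open>h powr (3 / 2)\<close>; squaring the sum turns the
  common factor into \<open>h\<close>.\<close>

lemma smallness:
  fixes \<omega> :: "real \<Rightarrow> real"
  assumes \<omega>: "(\<omega> \<longlongrightarrow> 0) (at_right 0)" and \<epsilon>: "0 < \<epsilon>"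
  obtains h0 where "0 < h0"
    "\<And>h k. \<lbrakk>0 < h; h \<le> h0; 0 < k; k \<le> \<omega> h * h powr (1 / 4)\<rbrakk> \<Longrightarrow> (k\<^sup>2 + h\<^sup>2)\<^sup>2 \<le> \<epsilon> * h"
proof -
  have "((\<lambda>h::real. h) \<longlongrightarrow> 0) (at_right 0)" by (intro tendsto_ident_at)
  moreover have "eventually (\<lambda>h::real. 0 \<le> h) (at_right 0)"
    by (simp add: eventually_at_filter)
  ultimately have "((\<lambda>h::real. h powr (3 / 2)) \<longlongrightarrow> 0) (at_right 0)"
    using tendsto_zero_powrI[of "\<lambda>h::real. h" "at_right 0" "\<lambda>_. 3 / 2" "3 / 2"] by simp
  with \<omega> have "((\<lambda>h. ((\<omega> h)\<^sup>2 + h powr (3 / 2))\<^sup>2) \<longlongrightarrow> (0\<^sup>2 + 0)\<^sup>2) (at_right 0)"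
    by (intro tendsto_power tendsto_add)
  then have "eventually (\<lambda>h. ((\<omega> h)\<^sup>2 + h powr (3 / 2))\<^sup>2 < \<epsilon>) (at_right 0)"
    using \<epsilon> by (intro order_tendstoD(2)) auto
  then obtain b where b: "0 < b" "\<And>h. 0 < h \<Longrightarrow> h < b \<Longrightarrow> ((\<omega> h)\<^sup>2 + h powr (3 / 2))\<^sup>2 < \<epsilon>"
    unfolding eventually_at_right_field by blast
  show thesis
  \<comment> \<open>The limit gives the bound for \<open>h < b\<close>; halving admits
    \<open>h \<le> h0\<close>.\<close>
  proof (rule that[of "b / 2"])
    show "0 < b / 2" using b by simp
    fix h k :: real assume h: "0 < h" "h \<le> b / 2" and k: "0 < k" "k \<le> \<omega> h * h powr (1 / 4)"
    have "k\<^sup>2 \<le> (\<omega> h * h powr (1 / 4))\<^sup>2" using k by (intro power_mono) auto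
    also have "\<dots> = (\<omega> h)\<^sup>2 * h powr (1 / 2)"
      using h by (simp add: power_mult_distrib power2_eq_square powr_add[symmetric])
    finally have 1: "k\<^sup>2 \<le> (\<omega> h)\<^sup>2 * h powr (1 / 2)" .
    have 2: "h\<^sup>2 = h powr (3 / 2) * h powr (1 / 2)"
      using h by (simp add: powr_add[symmetric])
    have "(k\<^sup>2 + h\<^sup>2)\<^sup>2 \<le> (((\<omega> h)\<^sup>2 + h powr (3 / 2)) * h powr (1 / 2))\<^sup>2"
      using 1 2 by (intro power_mono) (auto simp: distrib_right)
    also have "\<dots> = ((\<omega> h)\<^sup>2 + h powr (3 / 2))\<^sup>2 * h"
      unfolding power_mult_distrib using h by (simp add: power2_eq_square powr_add[symmetric])
    also have "\<dots> \<le> \<epsilon> * h" using b(2)[of h] h b(1) by (intro mult_right_mono) auto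
    finally show "(k\<^sup>2 + h\<^sup>2)\<^sup>2 \<le> \<epsilon> * h" .
  qed
qed

lemma expanding_radius_bounds:
  assumes "expanding_radius \<alpha> v_c T R0 R" "0 < T"
  obtains r0 r1 where "0 < r0" "\<And>t. t \<in> {0..T} \<Longrightarrow> r0 \<le> R t" "\<And>t. t \<in> {0..T} \<Longrightarrow> R t \<le> r1"
proof -
  have pos: "\<And>t. t \<in> {0..T} \<Longrightarrow> 0 < R t" and der: "\<And>t. t \<in> {0..T} \<Longrightarrow>
      (R has_real_derivative (v_c + (\<alpha> - 1) / R t)) (at t within {0..T})"
    using assms by (auto simp: expanding_radius_def)
  have "continuous_on {0..T} R" using der by (intro DERIV_continuous_on) auto
  moreover have "{0..T} \<noteq> {}" using assms by simp
  ultimately obtain s t where "s \<in> {0..T}" "\<forall>y\<in>{0..T}. R s \<le> R y" "\<forall>y\<in>{0..T}. R y \<le> R t"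
    using continuous_attains_inf[OF compact_Icc] continuous_attains_sup[OF compact_Icc] by metis
  then show thesis using that[of "R s" "R t"] pos by blast
qed

section \<open>Convergence\<close>

lemma grid_values_periodic:
  assumes "\<And>\<sigma>. v (\<sigma> + 2 * pi) (real n * k) = v \<sigma> (real n * k)" "1 \<le> J"
  shows "grid_values v (2 * pi / real J) k n \<in> periodic_grid J"
proof (rule periodic_gridI)
  fix i
  have "real_of_int (i + int J) * (2 * pi / real J) = real_of_int i * (2 * pi / real J) + 2 * pi"
    using assms(2) by (simp add: field_simps)
  then show "grid_values v (2 * pi / real J) k n (i + int J) = grid_values v (2 * pi / real J) k n i"
    using assms(1) by (simp only: grid_values_def)
qed

text \<open>The coupling of \<open>k\<close> and \<open>h\<close> occurs only as
  \<open>2 * pi * H * (k\<^sup>2 + h\<^sup>2)\<^sup>2 \<le> h\<close>, with \<open>H\<close> already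
  fixed. The threshold belonging to \<omega> can therefore be chosen afterwards and depend on
  \<open>H\<close>, without circularity.\<close>

lemma newton_error_bound:
  assumes T: "0 < T" and \<delta>: "0 < \<delta>" and R: "expanding_radius \<alpha> v_c T R0 R" and smooth: "Cp_strip 6 T v"
    and per: "\<And>\<sigma> t. t \<in> {0..T} \<Longrightarrow> v (\<sigma> + 2 * pi) t = v \<sigma> t"
    and pde: "solves_pde \<delta> \<alpha> v_c T R v"
  obtains H k0 where "0 < H" "0 < k0"
    "\<And>J N j V h k m. \<lbrakk>h = 2 * pi / real J; k = T / real N; 1 \<le> J; 1 \<le> N; k \<le> k0;
      2 * pi * H * (k\<^sup>2 + h\<^sup>2)\<^sup>2 \<le> h; \<forall>m\<in>{2..N}. 1 \<le> j m;
      newton_scheme \<delta> \<alpha> v_c R T J N j (grid_values v h k 0) V; m \<le> N\<rbrakk>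
    \<Longrightarrow> sq J (\<lambda>i. grid_values v h k m i - V m i) \<le> H * (real J * (k\<^sup>2 + h\<^sup>2)\<^sup>2)"
proof -
  obtain r0 r1 where r: "0 < r0" "\<And>t. t \<in> {0..T} \<Longrightarrow> r0 \<le> R t" "\<And>t. t \<in> {0..T} \<Longrightarrow> R t \<le> r1"
    by (rule expanding_radius_bounds[OF R T]) blast
  have r01: "0 < r1" using r(1) r(2)[of 0] r(3)[of 0] T by simp
  define d where "d = \<delta> / r1 ^ 4"
  have d: "0 < d" using \<delta> r01 by (simp add: d_def)
  obtain C where C: "0 \<le> C" "\<And>r. r0 \<le> r \<Longrightarrow> \<bar>\<delta> / r ^ 4\<bar> \<le> C"
    "\<And>r. r0 \<le> r \<Longrightarrow> \<bar>1 / r ^ 2 * (\<alpha> - 1 + \<delta> / r ^ 2)\<bar> \<le> C"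
    "\<And>r. r0 \<le> r \<Longrightarrow> \<bar>(\<alpha> - 1) / r ^ 2\<bar> \<le> C"
    "\<And>r. r0 \<le> r \<Longrightarrow> \<bar>v_c / r ^ 2\<bar> \<le> C"
    using coefficients_bounded[OF r(1), of \<delta> \<alpha> v_c] by metis
  have coef: "d \<le> \<delta> / R t ^ 4" "1 / R t ^ 2 * (\<alpha> - 1 + \<delta> / R t ^ 2) \<le> C" "- C \<le> (\<alpha> - 1) / R t ^ 2"
    "\<bar>v_c / (24 * (R t)\<^sup>2)\<bar> \<le> C" if t: "t \<in> {0..T}" for t
  proof -
    note rt = r(2)[OF t] r(3)[OF t]
    show "d \<le> \<delta> / R t ^ 4"
      unfolding d_def using rt r(1) \<delta> by (intro divide_left_mono power_mono) auto
    show "1 / R t ^ 2 * (\<alpha> - 1 + \<delta> / R t ^ 2) \<le> C" using C(3)[OF rt(1)] by linarith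
    show "- C \<le> (\<alpha> - 1) / R t ^ 2" using C(4)[OF rt(1)] by linarith
    have "\<bar>v_c / (24 * (R t)\<^sup>2)\<bar> = \<bar>v_c / R t ^ 2\<bar> / 24" by (simp add: abs_mult)
    also have "\<dots> \<le> \<bar>v_c / R t ^ 2\<bar>"
    proof -
      have "y / 24 \<le> y" if "0 \<le> y" for y :: real using that by simp
      then show ?thesis using abs_ge_zero by blast
    qed
    also have "\<dots> \<le> C" by (rule C(5)[OF rt(1)])
    finally show "\<bar>v_c / (24 * (R t)\<^sup>2)\<bar> \<le> C" .
  qed
  obtain B where B: "0 \<le> B"
    and vB: "\<And>\<sigma> t. \<sigma> \<in> {0..2 * pi} \<Longrightarrow> t \<in> {0..T} \<Longrightarrow> \<bar>v \<sigma> t\<bar> \<le> B"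
    and second: "\<And>\<sigma> t k. \<lbrakk>\<sigma> \<in> {0..2 * pi}; 0 < k; 0 \<le> t - k; t + k \<le> T\<rbrakk>
      \<Longrightarrow> \<bar>v \<sigma> (t + k) - 2 * v \<sigma> t + v \<sigma> (t - k)\<bar> \<le> B * k\<^sup>2"
    and trunc: "\<And>h k t i V0 V1. \<lbrakk>0 < h; h \<le> 2 * pi; 0 < k; 0 \<le> t - k / 2; t + k / 2 \<le> T;
        of_int i * h \<in> {0..2 * pi};
        V0 = (\<lambda>l. v (of_int l * h) (t - k / 2)); V1 = (\<lambda>l. v (of_int l * h) (t + k / 2))\<rbrakk>
      \<Longrightarrow> \<bar>1 / k * (V1 i - V0 i) + 1 / 2 * lin_op \<delta> \<alpha> (R t) h (\<lambda>l. V1 l + V0 l) i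
          - v_c / (24 * h * (R t)\<^sup>2) * phi (\<lambda>l. V1 l + V0 l) (\<lambda>l. V1 l + V0 l) i\<bar> \<le> B * (k\<^sup>2 + h\<^sup>2)"
    and trunc1: "\<And>h k t i V0 V1. \<lbrakk>0 < h; h \<le> 2 * pi; 0 < k; k \<le> 1; 0 \<le> t - k / 2; t + k / 2 \<le> T;
        of_int i * h \<in> {0..2 * pi};
        V0 = (\<lambda>l. v (of_int l * h) (t - k / 2)); V1 = (\<lambda>l. v (of_int l * h) (t + k / 2))\<rbrakk>
      \<Longrightarrow> \<bar>1 / k * (V1 i - V0 i) + 1 / 2 * lin_op \<delta> \<alpha> (R t) h (\<lambda>l. V1 l + V0 l) i
          - v_c / (6 * h * (R t)\<^sup>2) * phi V0 V0 i\<bar> \<le> B * (k + h\<^sup>2)"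
    using consistency[OF T smooth pde r(1,2)] by blast
  \<comment> \<open>Both \<open>U\<close> and \<theta> combine errors of size at most 1 with
    coefficients of total size 4, and values of \<open>v\<close> of size at most \<open>B\<close>
    with coefficients of total size 4.\<close>
  define A where "A = 4 * B + 4"
  obtain K where K: "0 \<le> K" and step: "\<And>\<delta> \<alpha> r h k J U \<theta> E E' e \<tau> c'.
    \<lbrakk>U \<in> periodic_grid J; \<theta> \<in> periodic_grid J; E \<in> periodic_grid J; E' \<in> periodic_grid J;
     e \<in> periodic_grid J; d \<le> \<delta> / r ^ 4; 1 / r ^ 2 * (\<alpha> - 1 + \<delta> / r ^ 2) \<le> C;
     - C \<le> (\<alpha> - 1) / r ^ 2; 0 < k; 0 < h; \<bar>c'\<bar> \<le> C; \<And>i. \<bar>U i\<bar> \<le> A; \<And>i. \<bar>\<theta> i\<bar> \<le> A;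
     \<And>i. i \<in> {1..int J} \<Longrightarrow> 1 / k * (E' i - e i) + 1 / 2 * lin_op \<delta> \<alpha> r h (\<lambda>l. E' l + e l) i
       = c' / h * (psi U (\<lambda>l. E l + e l) i + psi \<theta> \<theta> i / 2) + \<tau> i\<rbrakk>
    \<Longrightarrow> sq J E' \<le> sq J e + k * K * (sq J E + sq J E' + sq J e + sq J \<theta> + sq J \<tau>)"
    using newton_step_estimate[OF d C(1) C(1), of A] by blast
  obtain K1 where K1: "0 < K1" and first: "\<And>\<delta> \<alpha> r h k J E \<tau>.
    \<lbrakk>E \<in> periodic_grid J; d \<le> \<delta> / r ^ 4; 1 / r ^ 2 * (\<alpha> - 1 + \<delta> / r ^ 2) \<le> C;
     - C \<le> (\<alpha> - 1) / r ^ 2; 0 < k; k * K1 \<le> 1;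
     \<And>i. i \<in> {1..int J} \<Longrightarrow> 1 / k * E i + 1 / 2 * lin_op \<delta> \<alpha> r h E i = \<tau> i\<rbrakk>
    \<Longrightarrow> sq J E \<le> 2 * k\<^sup>2 * sq J \<tau>"
    using first_step_estimate[OF d C(1)] by blast
  \<comment> \<open>One constant for all requirements of \<open>iteration_bound\<close>:
    \<open>16 + 2 * B\<^sup>2\<close> controls the extrapolated first iterate, while
    \<open>37 = 1 + 36\<close> and \<open>3 = 2 + 1\<close> collect the contributions of
    \<open>e n\<close>, \<theta> and \<tau>.\<close>
  define L where "L = K * (37 + 3 * B\<^sup>2) + 16 + 2 * B\<^sup>2"
  have L: "16 \<le> L" "K \<le> L" "K * (37 + 3 * B\<^sup>2) \<le> L" "16 + 2 * B\<^sup>2 \<le> L"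
  proof -
    have "0 \<le> K * B\<^sup>2" using K by simp
    then show "16 \<le> L" "K \<le> L" "K * (37 + 3 * B\<^sup>2) \<le> L" "16 + 2 * B\<^sup>2 \<le> L"
      unfolding L_def using K by (simp_all add: algebra_simps)
  qed
  \<comment> \<open>The Gronwall constant: with \<open>\<kappa> = k * (3 * L\<^sup>2)\<close> and
    \<open>real N * k = T\<close> the exponent no longer contains \<open>k\<close>. The last factor
    is \<open>2 * B\<^sup>2\<close> from the first step, plus 1 for the \<rho> added to the error in
    that argument.\<close>
  define H where "H = exp (2 * (3 * L\<^sup>2) * T) * (2 * B\<^sup>2 + 1)"
  define k0 where "k0 = min 1 (min (1 / K1) (1 / (8 * L)))"
  show thesis
  proof (rule that[of H k0])
    show "0 < H" by (auto simp: H_def intro!: mult_pos_pos add_nonneg_pos)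
    show "0 < k0" using K1 L(1) by (simp add: k0_def)
    fix J N :: nat and j V and h k :: real and m :: nat
    assume h: "h = 2 * pi / real J" and k: "k = T / real N" and J: "1 \<le> J" and N: "1 \<le> N"
      and kk0: "k \<le> k0" and small: "2 * pi * H * (k\<^sup>2 + h\<^sup>2)\<^sup>2 \<le> h"
      and j: "\<forall>m\<in>{2..N}. 1 \<le> j m"
      and scheme: "newton_scheme \<delta> \<alpha> v_c R T J N j (grid_values v h k 0) V"
      and m: "m \<le> N"
    have hpos: "0 < h" and h2: "h \<le> 2 * pi" and kpos: "0 < k" and kN: "real N * k = T"
    proof -
      show "0 < h" using J by (simp add: h)
      show "h \<le> 2 * pi" using J by (simp add: h field_simps)
      show "0 < k" using N T by (simp add: k)
      show "real N * k = T" using N by (simp add: k)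
    qed
    have k1: "k \<le> 1" and kK1: "k * K1 \<le> 1" and kL: "k * L \<le> 1 / 8"
      using kk0 K1 L(1) by (auto simp: k0_def field_simps)
    have time: "real n * k \<in> {0..T}" if "n \<le> N" for n
      using that kpos kN mult_right_mono[of "real n" "real N" k] by auto
    have space: "of_int i * h \<in> {0..2 * pi}" if "i \<in> {1..int J}" for i
    proof -
      have "of_int i * h \<le> real J * h" using that hpos by (intro mult_right_mono) auto
      also have "\<dots> = 2 * pi" using J by (simp add: h)
      finally show ?thesis using that hpos by auto
    qed
    define u where "u n = grid_values v h k n" for n
    define e where "e n = (\<lambda>i. u n i - V n i)" for n
    \<comment> \<open>The square of a pointwise error \<open>k\<^sup>2 + h\<^sup>2\<close> summed
      over one period. As \<open>gip\<close> is unweighted, the factor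
      \<open>2 * pi / real J\<close> of the norm returns only at the very end.\<close>
    define \<rho> where "\<rho> = real J * (k\<^sup>2 + h\<^sup>2)\<^sup>2"
    have \<rho>: "0 \<le> \<rho>" by (simp add: \<rho>_def)
    have uper: "u n \<in> periodic_grid J" if "n \<le> N" for n
      unfolding u_def h using grid_values_periodic per time that J by simp
    have Vper: "V n \<in> periodic_grid J" if "n \<le> N" for n
      using scheme that by (simp add: newton_scheme_def Let_def)
    have eper: "e n \<in> periodic_grid J" if "n \<le> N" for n
      unfolding e_def using uper[OF that] Vper[OF that] by (rule periodic_grid_pointwise)
    have uB: "\<bar>u n i\<bar> \<le> B" if "n \<le> N" for n i
    proof (rule periodic_grid_bounded[OF uper[OF that] J])
      show "\<bar>u n i\<bar> \<le> B" if "i \<in> {1..int J}" for i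
        unfolding u_def grid_values_def by (rule vB[OF space[OF that] time[OF \<open>n \<le> N\<close>]])
    qed
    have "V 0 = u 0 \<and> first_step \<delta> \<alpha> v_c R h k (V 0) (V 1) \<and>
      (\<forall>n\<in>{1..<N}. \<exists>W :: nat \<Rightarrow> grid_fun.
         (\<forall>l\<le>j (n + 1). W l \<in> periodic_grid J) \<and>
         W 0 = (\<lambda>i. 2 * V n i - V (n - 1) i) \<and>
         (\<forall>l<j (n + 1). newton_iterate \<delta> \<alpha> v_c R h k n (V n) (\<lambda>i. 2 * V n i - V (n - 1) i)
            (W l) (W (l + 1))) \<and>
         V (n + 1) = W (j (n + 1)))"
      using scheme unfolding newton_scheme_def Let_def h[symmetric] k[symmetric] u_def
      by (rule conjunct2)
    note V0 = this[THEN conjunct1] and V1 = this[THEN conjunct2, THEN conjunct1]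
      and newton = this[THEN conjunct2, THEN conjunct2]
    have e0: "sq J (e 0) = 0" by (simp add: e_def V0 gip_def)
    have e1: "sq J (e 1) \<le> 2 * B\<^sup>2 * \<rho>"
    proof -
      define t where "t = 1 / 2 * k"
      have t: "t \<in> {0..T}" "t - k / 2 = real 0 * k" "t + k / 2 = real 1 * k" "t + k / 2 \<le> T"
        using kpos time[of 1] N by (auto simp: t_def)
      define \<tau> where "\<tau> i = 1 / k * (u 1 i - u 0 i) + 1 / 2 * lin_op \<delta> \<alpha> (R t) h (\<lambda>l. u 1 l + u 0 l) i
          - v_c / (6 * h * (R t)\<^sup>2) * phi (u 0) (u 0) i" for i
      have "sq J (e 1) \<le> 2 * k\<^sup>2 * sq J \<tau>"
      proof (rule first[OF eper[OF N] coef(1-3)[OF t(1)] kpos kK1])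
        fix i assume "i \<in> {1..int J}"
        have V1': "1 / k * (V 1 i - V 0 i) + 1 / 2 * lin_op \<delta> \<alpha> (R t) h (\<lambda>l. V 1 l + V 0 l) i
          = v_c / (6 * h * (R t)\<^sup>2) * phi (u 0) (u 0) i"
          using V1 by (simp add: first_step_def Let_def t_def V0)
        have "e 1 = (\<lambda>l. (u 1 l + u 0 l) - (V 1 l + V 0 l))" by (simp add: e_def V0)
        then have L: "lin_op \<delta> \<alpha> (R t) h (e 1) i = lin_op \<delta> \<alpha> (R t) h (\<lambda>l. u 1 l + u 0 l) i
            - lin_op \<delta> \<alpha> (R t) h (\<lambda>l. V 1 l + V 0 l) i"
          by (simp only: lin_op_diff)
        have "e 1 i = (u 1 i - u 0 i) - (V 1 i - V 0 i)" by (simp add: e_def V0)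
        then show "1 / k * e 1 i + 1 / 2 * lin_op \<delta> \<alpha> (R t) h (e 1) i = \<tau> i"
          unfolding L \<tau>_def V1'[symmetric] by (simp only: right_diff_distrib)
      qed
      also have "sq J \<tau> \<le> real J * (B * (k + h\<^sup>2))\<^sup>2"
      proof (rule sq_le_const)
        fix i assume i: "i \<in> {1..int J}"
        show "\<bar>\<tau> i\<bar> \<le> B * (k + h\<^sup>2)"
          unfolding \<tau>_def
          by (rule trunc1[OF hpos h2 kpos k1 _ t(4) space[OF i]])
            (simp_all add: u_def grid_values_def t del: of_nat_Suc)
      qed
      also have "2 * k\<^sup>2 * (real J * (B * (k + h\<^sup>2))\<^sup>2) = 2 * B\<^sup>2 * (real J * (k * (k + h\<^sup>2))\<^sup>2)"
        by (simp add: power_mult_distrib)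
      also have "\<dots> \<le> 2 * B\<^sup>2 * \<rho>"
      proof -
        have "k * h\<^sup>2 \<le> h\<^sup>2" using k1 mult_right_mono[of k 1 "h\<^sup>2"] by simp
        then have "k * (k + h\<^sup>2) \<le> k\<^sup>2 + h\<^sup>2" by (simp add: power2_eq_square algebra_simps)
        then show ?thesis unfolding \<rho>_def using kpos
          by (intro mult_left_mono power_mono) auto
      qed
      finally show ?thesis by (simp add: mult_left_mono)
    qed
    have Heq: "exp (2 * (k * (3 * L\<^sup>2)) * real N) * ((2 * B\<^sup>2 + 1) * \<rho>) = H * \<rho>"
      using kN by (simp add: H_def mult.commute mult.left_commute)
    have "sq J (e m) \<le> exp (2 * (k * (3 * L\<^sup>2)) * real N) * ((2 * B\<^sup>2 + 1) * \<rho>)"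
    proof (rule discrete_gronwall[OF _ _ _ _ \<rho> _ m])
      show "0 \<le> k * (3 * L\<^sup>2)" using kpos by simp
      have "0 \<le> 2 * B\<^sup>2 * \<rho>" using \<rho> by simp
      then show "sq J (e 0) + \<rho> \<le> (2 * B\<^sup>2 + 1) * \<rho>" "sq J (e 1) + \<rho> \<le> (2 * B\<^sup>2 + 1) * \<rho>"
          "0 \<le> (2 * B\<^sup>2 + 1) * \<rho>"
        using e0 e1 \<rho> by (auto simp: distrib_right)
    next
      fix n assume n: "1 \<le> n" "n < N"
        and IH: "\<And>m. m \<le> n \<Longrightarrow> sq J (e m) \<le> exp (2 * (k * (3 * L\<^sup>2)) * real N) * ((2 * B\<^sup>2 + 1) * \<rho>)"
      have nN: "n \<le> N" "n - 1 \<le> N" "Suc n \<le> N" using n by auto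
      \<comment> \<open>The inverse inequality in elementary form: one squared entry is at most the
        whole sum, and \<open>real J = 2 * pi / h\<close> produces the division by \<open>h\<close>
        that the smallness condition compensates.\<close>
      have esmall: "\<bar>e l i\<bar> \<le> 1" if l: "l \<le> n" for l i
      proof (rule periodic_grid_bounded[OF eper J])
        show "l \<le> N" using l n by simp
        fix i assume i: "i \<in> {1..int J}"
        have "(e l i)\<^sup>2 \<le> H * \<rho>" using le_sq[OF i, of "e l"] IH[OF l] Heq by linarith
        also have "\<dots> = 2 * pi * H * (k\<^sup>2 + h\<^sup>2)\<^sup>2 / h" using J by (simp add: \<rho>_def h)
        also have "\<dots> \<le> 1" using small hpos by simp
        finally show "\<bar>e l i\<bar> \<le> 1" by (simp add: abs_square_le_1)
      qed
      define t where "t = (real n + 1 / 2) * k"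
      have t2: "t - k / 2 = real n * k" "t + k / 2 = real (Suc n) * k"
        by (simp_all add: t_def algebra_simps)
      have t23: "0 \<le> t - k / 2" "t + k / 2 \<le> T"
        using time[OF nN(1)] time[OF nN(3)] unfolding t2 by simp_all
      then have t: "t \<in> {0..T}" "0 \<le> t - k / 2" "t + k / 2 \<le> T"
        using kpos by simp_all
      \<comment> \<open>The extrapolation error of the exact solution. Both \<theta> and the error
        \<open>E 0\<close> of the extrapolated value are combinations of \<open>e n\<close> and
        \<open>e (n - 1)\<close> plus \<open>d'\<close>; the factors 1 below match the shape of
        \<open>sq_lincomb2\<close>.\<close>
      define d' where "d' = (\<lambda>i. u (Suc n) i - 2 * u n i + u (n - 1) i)"
      define Vh where "Vh = (\<lambda>i. 2 * V n i - V (n - 1) i)"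
      define U where "U = (\<lambda>l. V n l + Vh l)"
      define \<theta> where "\<theta> = (\<lambda>l. u (Suc n) l + u n l - U l)"
      obtain W where W: "\<And>l. l \<le> j (Suc n) \<Longrightarrow> W l \<in> periodic_grid J" "W 0 = Vh"
          "\<And>l. l < j (Suc n) \<Longrightarrow> newton_iterate \<delta> \<alpha> v_c R h k n (V n) Vh (W l) (W (Suc l))"
          "V (Suc n) = W (j (Suc n))"
        using newton n unfolding Vh_def by fastforce
      have jn: "1 \<le> j (Suc n)" using j n by simp
      have d': "\<bar>d' i\<bar> \<le> B * (k\<^sup>2 + h\<^sup>2)" if i: "i \<in> {1..int J}" for i
      proof -
        have tn: "real n * k + k = real (Suc n) * k" "real n * k - k = real (n - 1) * k"
          using n by (simp_all add: algebra_simps of_nat_diff)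
        have "\<bar>v (of_int i * h) (real n * k + k) - 2 * v (of_int i * h) (real n * k)
            + v (of_int i * h) (real n * k - k)\<bar> \<le> B * k\<^sup>2"
          by (rule second[OF space[OF i] kpos])
            (use time[OF nN(2)] time[OF nN(3)] in \<open>simp_all only: tn atLeastAtMost_iff\<close>)
        then have "\<bar>d' i\<bar> \<le> B * k\<^sup>2" unfolding tn d'_def u_def grid_values_def .
        also have "\<dots> \<le> B * (k\<^sup>2 + h\<^sup>2)" using B by (intro mult_left_mono) auto
        finally show ?thesis .
      qed
      have sqd: "sq J d' \<le> B\<^sup>2 * \<rho>"
        using sq_le_const[of J d', OF d'] by (simp add: \<rho>_def power_mult_distrib mult.left_commute)
      have \<theta>_eq: "\<theta> = (\<lambda>i. 1 * (3 * e n i + (- 1) * e (n - 1) i) + 1 * d' i)"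
        by (rule ext) (simp add: \<theta>_def U_def Vh_def d'_def e_def)
      have sq\<theta>: "sq J \<theta> \<le> 36 * sq J (e n) + 4 * sq J (e (n - 1)) + 2 * (B\<^sup>2 * \<rho>)"
        unfolding \<theta>_eq
        using sq_lincomb2[of J 1 "\<lambda>i. 3 * e n i + (- 1) * e (n - 1) i" 1 d']
          sq_lincomb2[of J 3 "e n" "- 1" "e (n - 1)"] sqd by simp
      have UA: "\<bar>U i\<bar> \<le> A" for i
      proof -
        have "U i = 3 * (u n i - e n i) - (u (n - 1) i - e (n - 1) i)"
          by (simp add: U_def Vh_def e_def)
        then show ?thesis
          using uB[OF nN(1), of i] uB[OF nN(2), of i] esmall[OF order_refl, of i] esmall[OF diff_le_self, of 1 i]
          unfolding A_def abs_le_iff right_diff_distrib by linarith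
      qed
      have \<theta>A: "\<bar>\<theta> i\<bar> \<le> A" for i
      proof -
        have "\<theta> i = 3 * e n i - e (n - 1) i + u (Suc n) i - 2 * u n i + u (n - 1) i"
          by (simp add: \<theta>_eq d'_def)
        then show ?thesis
          using uB[OF nN(1), of i] uB[OF nN(2), of i] uB[OF nN(3), of i]
            esmall[OF order_refl, of i] esmall[OF diff_le_self, of 1 i]
          unfolding A_def abs_le_iff by linarith
      qed
      have Uper: "U \<in> periodic_grid J"
        unfolding U_def Vh_def
        by (intro periodic_gridI) (simp only: periodic_gridD[OF Vper[OF nN(1)]] periodic_gridD[OF Vper[OF nN(2)]])
      have \<theta>per: "\<theta> \<in> periodic_grid J"
        unfolding \<theta>_def by (intro periodic_gridI) (simp only: periodic_gridD[OF uper[OF nN(1)]]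
            periodic_gridD[OF uper[OF nN(3)]] periodic_gridD[OF Uper])
      define \<tau> where "\<tau> i = 1 / k * (u (Suc n) i - u n i)
          + 1 / 2 * lin_op \<delta> \<alpha> (R t) h (\<lambda>l. u (Suc n) l + u n l) i
          - v_c / (24 * h * (R t)\<^sup>2) * phi (\<lambda>l. u (Suc n) l + u n l) (\<lambda>l. u (Suc n) l + u n l) i" for i
      have sq\<tau>: "sq J \<tau> \<le> B\<^sup>2 * \<rho>"
      proof -
        have "sq J \<tau> \<le> real J * (B * (k\<^sup>2 + h\<^sup>2))\<^sup>2"
        proof (rule sq_le_const)
          fix i assume i: "i \<in> {1..int J}"
          show "\<bar>\<tau> i\<bar> \<le> B * (k\<^sup>2 + h\<^sup>2)"
            unfolding \<tau>_def
            by (rule trunc[OF hpos h2 kpos t(2,3) space[OF i]])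
              (simp_all only: u_def grid_values_def t2)
        qed
        then show ?thesis by (simp add: \<rho>_def power_mult_distrib mult.left_commute)
      qed
      define E where "E l = (\<lambda>i. u (Suc n) i - W l i)" for l
      have Eper: "E l \<in> periodic_grid J" if "l \<le> j (Suc n)" for l
        unfolding E_def using uper[OF nN(3)] W(1)[OF that] by (rule periodic_grid_pointwise)
      define S where "S = sq J (e n) + sq J (e (n - 1)) + \<rho>"
      have S: "0 \<le> S" "sq J (e n) \<le> S" using \<rho> by (simp_all add: S_def)
      \<comment> \<open>Here \<open>sq J (e n)\<close> plays the part of \<open>a\<close>: up to
        terms of order \<open>k\<close> the new error is the old one, whatever the number of
        iterations.\<close>
      have "sq J (E (j (Suc n))) \<le> sq J (e n) + k * (3 * L\<^sup>2) * S"
      proof (rule iteration_bound[where x = "\<lambda>l. sq J (E l)", OF _ _ kL _ S(2) _ _ _ jn])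
        show "4 \<le> L" using L(1) by simp
        show "sq J (E 0) \<le> L * S"
        proof -
          have E0: "E 0 = (\<lambda>i. 1 * (2 * e n i + (- 1) * e (n - 1) i) + 1 * d' i)"
            by (rule ext) (simp add: E_def W(2) Vh_def d'_def e_def)
          have "sq J (E 0) \<le> 16 * sq J (e n) + 4 * sq J (e (n - 1)) + 2 * (B\<^sup>2 * \<rho>)"
            unfolding E0
            using sq_lincomb2[of J 1 "\<lambda>i. 2 * e n i + (- 1) * e (n - 1) i" 1 d']
              sq_lincomb2[of J 2 "e n" "- 1" "e (n - 1)"] sqd by simp
          also have "\<dots> \<le> (16 + 2 * B\<^sup>2) * S"
          proof -
            have "0 \<le> B\<^sup>2 * sq J (e n)" "0 \<le> B\<^sup>2 * sq J (e (n - 1))" by simp_all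
            then show ?thesis unfolding S_def
              using \<rho> sq_nonneg[of J "e n"] sq_nonneg[of J "e (n - 1)"] by (simp add: algebra_simps)
          qed
          also have "\<dots> \<le> L * S" using L(4) S by (intro mult_right_mono) auto
          finally show ?thesis .
        qed
        fix l assume l: "l < j (Suc n)"
        have "sq J (E (Suc l)) \<le> sq J (e n)
            + k * K * (sq J (E l) + sq J (E (Suc l)) + sq J (e n) + sq J \<theta> + sq J \<tau>)"
        proof (rule step[OF Uper \<theta>per Eper Eper eper[OF nN(1)] coef(1-3)[OF t(1)] kpos hpos
              coef(4)[OF t(1)] UA \<theta>A])
          show "l \<le> j (Suc n)" "Suc l \<le> j (Suc n)" using l by auto
          fix i assume "i \<in> {1..int J}"
          \<comment> \<open>The factor \<open>1 / h\<close> is split off because \<open>psi\<close>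
            is controlled only together with the division by \<open>h\<close>.\<close>
          have c: "v_c / (24 * (R t)\<^sup>2) / h = v_c / (24 * h * (R t)\<^sup>2)" by simp
          show "1 / k * (E (Suc l) i - e n i) + 1 / 2 * lin_op \<delta> \<alpha> (R t) h (\<lambda>la. E (Suc l) la + e n la) i
            = v_c / (24 * (R t)\<^sup>2) / h * (psi U (\<lambda>la. E l la + e n la) i + psi \<theta> \<theta> i / 2) + \<tau> i"
            unfolding E_def e_def c
          proof (rule newton_error_equation[OF _ _ U_def \<theta>_def])
            show "1 / k * (W (Suc l) i - V n i) + 1 / 2 * lin_op \<delta> \<alpha> (R t) h (\<lambda>la. W (Suc l) la + V n la) i
              = v_c / (24 * h * (R t)\<^sup>2) * (psi U (\<lambda>la. W l la - Vh la) i + phi U U i)"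
              using W(3)[OF l] unfolding newton_iterate_def Let_def t_def U_def by blast
          qed (simp add: \<tau>_def)
        qed
        also have "\<dots> \<le> sq J (e n) + k * (L * (sq J (E l) + sq J (E (Suc l)) + S))"
        proof -
          have "sq J (e n) + sq J \<theta> + sq J \<tau> \<le> (37 + 3 * B\<^sup>2) * S"
          proof -
            have "0 \<le> B\<^sup>2 * sq J (e n)" "0 \<le> B\<^sup>2 * sq J (e (n - 1))" by simp_all
            moreover have "(37 + 3 * B\<^sup>2) * S = 37 * sq J (e n) + 37 * sq J (e (n - 1)) + 37 * \<rho>
                + 3 * (B\<^sup>2 * sq J (e n)) + 3 * (B\<^sup>2 * sq J (e (n - 1))) + 3 * (B\<^sup>2 * \<rho>)"
              by (simp add: S_def algebra_simps)
            ultimately show ?thesis using sq\<theta> sq\<tau> \<rho> sq_nonneg[of J "e n"]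
              sq_nonneg[of J "e (n - 1)"] by linarith
          qed
          then have "K * (sq J (e n) + sq J \<theta> + sq J \<tau>) \<le> K * ((37 + 3 * B\<^sup>2) * S)"
            using K by (intro mult_left_mono) auto
          also have "\<dots> \<le> L * S"
            unfolding mult.assoc[symmetric] using L(3) S by (intro mult_right_mono) auto
          finally have "K * (sq J (e n) + sq J \<theta> + sq J \<tau>) \<le> L * S" .
          moreover have "K * (sq J (E l) + sq J (E (Suc l))) \<le> L * (sq J (E l) + sq J (E (Suc l)))"
            using L(2) by (intro mult_right_mono) auto
          ultimately have "K * (sq J (E l) + sq J (E (Suc l)) + sq J (e n) + sq J \<theta> + sq J \<tau>)
              \<le> L * (sq J (E l) + sq J (E (Suc l)) + S)"
            by (simp add: algebra_simps)
          then show ?thesis using kpos by (simp add: mult.assoc)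
        qed
        finally show "sq J (E (Suc l)) \<le> sq J (e n) + k * L * (sq J (E l) + sq J (E (Suc l)) + S)"
          by (simp add: mult.assoc)
      qed (use kpos in auto)
      moreover have "E (j (Suc n)) = e (Suc n)" by (simp add: E_def e_def W(4))
      ultimately show "sq J (e (Suc n)) \<le> sq J (e n)
          + k * (3 * L\<^sup>2) * (sq J (e n) + sq J (e (n - 1)) + \<rho>)"
        by (simp add: S_def)
    qed
    then show "sq J (\<lambda>i. grid_values v h k m i - V m i) \<le> H * (real J * (k\<^sup>2 + h\<^sup>2)\<^sup>2)"
      unfolding Heq by (simp add: e_def u_def \<rho>_def)
  qed
qed

theorem theorem2:
  shows "\<exists>p::nat. \<forall>(\<delta>::real) (\<alpha>::real) (v_c::real) (T::real) (R0::real) (R::real \<Rightarrow> real)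
           (v::real \<Rightarrow> real \<Rightarrow> real) (M::real).
    0 < \<delta> \<and> 0 < \<alpha> \<and> 0 < T \<and> 0 < M \<and>
    expanding_radius \<alpha> v_c T R0 R \<and>
    Cp_strip p T v \<and>
    (\<forall>\<sigma>. \<forall>t\<in>{0..T}. v (\<sigma> + 2 * pi) t = v \<sigma> t) \<and>
    (\<forall>t\<in>{0..T}. integral {0..2 * pi} (\<lambda>\<sigma>. v \<sigma> t) = 0) \<and>
    solves_pde \<delta> \<alpha> v_c T R v \<and>
    (\<forall>t\<in>{0..T}. \<forall>\<sigma>. \<bar>deriv (\<lambda>s. v s t) \<sigma>\<bar> \<le> M)
    \<longrightarrow>
    (\<forall>\<omega>::real \<Rightarrow> real. (\<omega> \<longlongrightarrow> 0) (at_right 0) \<longrightarrow>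
      (\<exists>k0>0. \<exists>h0>0. \<exists>c>0. \<forall>(J::nat) (N::nat) (j::nat \<Rightarrow> nat) (V::nat \<Rightarrow> grid_fun).
        let h = 2 * pi / real J; k = T / real N in
        1 \<le> J \<and> 1 \<le> N \<and> h \<le> h0 \<and> k \<le> k0 \<and> k \<le> \<omega> h * h powr (1 / 4) \<and>
        h * (\<Sum>i = 1..int J. grid_values v h k 0 i) = 0 \<and>
        (\<forall>m\<in>{2..N}. 1 \<le> j m) \<and>
        newton_scheme \<delta> \<alpha> v_c R T J N j (grid_values v h k 0) V
        \<longrightarrow>
        Max ((\<lambda>n. grid_norm J (\<lambda>i. grid_values v h k n i - V n i)) ` {0..N}) \<le> c * (k\<^sup>2 + h\<^sup>2)))"
proof (rule exI[of _ 6], intro allI impI, elim conjE)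
  fix \<delta> \<alpha> v_c T R0 M :: real and R \<omega> :: "real \<Rightarrow> real" and v :: "real \<Rightarrow> real \<Rightarrow> real"
  assume \<delta>: "0 < \<delta>" and T: "0 < T" and R: "expanding_radius \<alpha> v_c T R0 R" and smooth: "Cp_strip 6 T v"
    and per: "\<forall>\<sigma>. \<forall>t\<in>{0..T}. v (\<sigma> + 2 * pi) t = v \<sigma> t"
    and pde: "solves_pde \<delta> \<alpha> v_c T R v" and \<omega>: "(\<omega> \<longlongrightarrow> 0) (at_right (0::real))"
  obtain H k0 where H: "0 < H" and k0: "0 < k0"
    and bound: "\<And>J N j V h k m. \<lbrakk>h = 2 * pi / real J; k = T / real N; 1 \<le> J; 1 \<le> N; k \<le> k0;
      2 * pi * H * (k\<^sup>2 + h\<^sup>2)\<^sup>2 \<le> h; \<forall>m\<in>{2..N}. 1 \<le> j m;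
      newton_scheme \<delta> \<alpha> v_c R T J N j (grid_values v h k 0) V; m \<le> N\<rbrakk>
    \<Longrightarrow> sq J (\<lambda>i. grid_values v h k m i - V m i) \<le> H * (real J * (k\<^sup>2 + h\<^sup>2)\<^sup>2)"
  proof (rule newton_error_bound[OF T \<delta> R smooth _ pde], goal_cases)
    case (1 \<sigma> t)
    then show ?case using per by blast
  next
    case (2 H k0)
    from 2(2-) show ?case by (rule 2(1))
  qed
  \<comment> \<open>The choice of \<epsilon> is dictated by the smallness condition in
    \<open>bound\<close>.\<close>
  obtain h0 where h0: "0 < h0"
    and small: "\<And>h k. \<lbrakk>0 < h; h \<le> h0; 0 < k; k \<le> \<omega> h * h powr (1 / 4)\<rbrakk>
      \<Longrightarrow> (k\<^sup>2 + h\<^sup>2)\<^sup>2 \<le> 1 / (2 * pi * H) * h"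
    using smallness[OF \<omega>, of "1 / (2 * pi * H)"] H by auto
  \<comment> \<open>The factor \<open>2 * pi\<close> is the total weight \<open>real J * h\<close>
    of the grid points of one period.\<close>
  define c where "c = sqrt (2 * pi * H)"
  show "\<exists>k0>0. \<exists>h0>0. \<exists>c>0. \<forall>(J::nat) (N::nat) (j::nat \<Rightarrow> nat) (V::nat \<Rightarrow> grid_fun).
        let h = 2 * pi / real J; k = T / real N in
        1 \<le> J \<and> 1 \<le> N \<and> h \<le> h0 \<and> k \<le> k0 \<and> k \<le> \<omega> h * h powr (1 / 4) \<and>
        h * (\<Sum>i = 1..int J. grid_values v h k 0 i) = 0 \<and>
        (\<forall>m\<in>{2..N}. 1 \<le> j m) \<and>
        newton_scheme \<delta> \<alpha> v_c R T J N j (grid_values v h k 0) V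
        \<longrightarrow>
        Max ((\<lambda>n. grid_norm J (\<lambda>i. grid_values v h k n i - V n i)) ` {0..N}) \<le> c * (k\<^sup>2 + h\<^sup>2)"
    unfolding Let_def
  proof (rule exI[of _ k0], rule conjI[OF k0], rule exI[of _ h0], rule conjI[OF h0],
      rule exI[of _ c], intro conjI allI impI)
    show "0 < c" using H by (simp add: c_def)
  next
    fix J N j V
    define h k where "h = 2 * pi / real J" and "k = T / real N"
    assume "1 \<le> J \<and> 1 \<le> N \<and> 2 * pi / real J \<le> h0 \<and> T / real N \<le> k0 \<and>
        T / real N \<le> \<omega> (2 * pi / real J) * (2 * pi / real J) powr (1 / 4) \<and>
        2 * pi / real J * (\<Sum>i = 1..int J. grid_values v (2 * pi / real J) (T / real N) 0 i) = 0 \<and>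
        (\<forall>m\<in>{2..N}. 1 \<le> j m) \<and>
        newton_scheme \<delta> \<alpha> v_c R T J N j (grid_values v (2 * pi / real J) (T / real N) 0) V"
    then have J: "1 \<le> J" and N: "1 \<le> N" and j: "\<forall>m\<in>{2..N}. 1 \<le> j m"
      and hk: "h \<le> h0" "k \<le> k0" "k \<le> \<omega> h * h powr (1 / 4)"
      and scheme: "newton_scheme \<delta> \<alpha> v_c R T J N j (grid_values v h k 0) V"
      unfolding h_def k_def by blast+
    have "0 < h" "0 < k" using J N T by (auto simp: h_def k_def)
    then have sm: "2 * pi * H * (k\<^sup>2 + h\<^sup>2)\<^sup>2 \<le> h"
      using small[of h k] hk H by (simp add: field_simps)
    have "grid_norm J (\<lambda>i. grid_values v h k n i - V n i) \<le> c * (k\<^sup>2 + h\<^sup>2)" if "n \<le> N" for n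
    proof -
      have "2 * pi / real J * sq J (\<lambda>i. grid_values v h k n i - V n i)
          \<le> 2 * pi / real J * (H * (real J * (k\<^sup>2 + h\<^sup>2)\<^sup>2))"
        by (intro mult_left_mono bound[OF h_def k_def J N hk(2) sm j scheme that]) simp
      also have "\<dots> = 2 * pi * H * (k\<^sup>2 + h\<^sup>2)\<^sup>2" using J by simp
      finally have "grid_norm J (\<lambda>i. grid_values v h k n i - V n i) \<le> sqrt (2 * pi * H * (k\<^sup>2 + h\<^sup>2)\<^sup>2)"
        by (simp add: grid_norm_def gip_def power2_eq_square)
      also have "\<dots> = c * (k\<^sup>2 + h\<^sup>2)" by (simp add: c_def real_sqrt_mult)
      finally show ?thesis .
    qed
    then show "Max ((\<lambda>n. grid_norm J (\<lambda>i. grid_values v (2 * pi / real J) (T / real N) n i - V n i)) ` {0..N})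
        \<le> c * ((T / real N)\<^sup>2 + (2 * pi / real J)\<^sup>2)"
      unfolding h_def[symmetric] k_def[symmetric] by (intro Max.boundedI) auto
  qed
qed

end
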